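(* Let $X$ be a compact metric space, $S:X\to X$ a homeomorphism, and $\boldsymbol u\in X$. Suppose that $\boldsymbol u$ is quasi-generic along an increasing sequence $(N_k)$ of natural integers for an $S$-invariant probability measure $\kappa$, i.e. $\kappa=\lim_{k\to\infty}\frac1{N_k}\sum_{1\le n\le N_k}\delta_{S^n\boldsymbol u}$ (weak-$*$), and let $\lambda$ be a 2-fold self-joining of $(X,\kappa,S)$. Then there exists a locally orbital sequence $(\phi_k)$, where each $\phi_k$ is a permutation of $\{1,\dots,N_k\}$, such that $$\lambda=\lim_{k\to\infty}\frac1{N_k}\sum_{1\le n\le N_k}\delta_{(S^n\boldsymbol u,\,S^{\phi_k(n)}\boldsymbol u)}\quad\text{(weak-}*\text{)}.$$
   Context: A 2-fold self-joining of $(X,\kappa,S)$ is an $S\times S$-invariant Borel probability measure on $X\times X$ with both marginals equal to $\kappa$. A sequence $(\phi_k)_{k\ge1}$, with $\phi_k$ a permutation of $\{1,\dots,N_k\}$, is locally orbital if $$\frac1{N_k}\Bigl|\bigl\{n\in\{1,\dots,N_k-1\}:\phi_k(n+1)=\phi_k(n)+1\bigr\}\Bigr|\longrightarrow1\quad(k\to\infty).$$ *)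

theory Defs
  imports "HOL-Probability.Probability" "HOL-Combinatorics.Permutations"
begin

text \<open>
  The Borel measure \<open>(1 / N) * (\<delta>(x 1) + \<dots> + \<delta>(x N))\<close>, obtained as the law of \<open>x\<close> under the
  uniform distribution on \<open>{1..N}\<close>. For \<open>N = 0\<close> it is the null measure.
\<close>

definition empirical_measure :: "nat \<Rightarrow> (nat \<Rightarrow> 'a::topological_space) \<Rightarrow> 'a measure" where
  "empirical_measure N x = distr (uniform_count_measure {1..N}) borel x"

lemma emeasure_empirical_measure:
  assumes "A \<in> sets borel"
  shows "emeasure (empirical_measure N x) A
    = ennreal (1 / real N) * (\<Sum>n = 1..N. emeasure (return borel (x n)) A)"
proof -
  have "emeasure (empirical_measure N x) A
      = emeasure (uniform_count_measure {1..N}) (x -` A \<inter> {1..N})"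
    unfolding empirical_measure_def using assms
    by (subst emeasure_distr)
       (auto simp: uniform_count_measure_def point_measure_def measurable_def)
  also have "\<dots> = ennreal (real (card (x -` A \<inter> {1..N})) / real N)"
    by (subst emeasure_uniform_count_measure) auto
  also have "\<dots> = ennreal (1 / real N) * of_nat (card (x -` A \<inter> {1..N}))"
    by (simp add: ennreal_mult'[symmetric] ennreal_of_nat_eq_real_of_nat)
  also have "of_nat (card (x -` A \<inter> {1..N})) = (\<Sum>n = 1..N. emeasure (return borel (x n)) A)"
    using assms
    by (simp add: emeasure_return indicator_def sum.If_cases Int_def conj_commute)
  finally show ?thesis .
qed

text \<open>
  Weak-* convergence of finite Borel measures on a compact space; by compactness the test
  functions need not be required to be bounded.
\<close>

definition weak_star_conv ::
    "(nat \<Rightarrow> 'a::topological_space measure) \<Rightarrow> 'a measure \<Rightarrow> bool" where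
  "weak_star_conv M \<mu> \<longleftrightarrow>
    (\<forall>f :: 'a \<Rightarrow> real. continuous_on UNIV f \<longrightarrow>
      (\<lambda>k. \<integral>x. f x \<partial>M k) \<longlonglongrightarrow> (\<integral>x. f x \<partial>\<mu>))"

text \<open>Intended for continuous (in particular Borel measurable) maps \<open>S\<close>.\<close>

definition invariant_prob ::
    "('a::topological_space \<Rightarrow> 'a) \<Rightarrow> 'a measure \<Rightarrow> bool" where
  "invariant_prob S \<mu> \<longleftrightarrow> prob_space \<mu> \<and> sets \<mu> = sets borel \<and> distr \<mu> borel S = \<mu>"

definition quasi_generic ::
    "('a::topological_space \<Rightarrow> 'a) \<Rightarrow> (nat \<Rightarrow> nat) \<Rightarrow> 'a \<Rightarrow> 'a measure \<Rightarrow> bool" where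
  "quasi_generic S N u \<kappa> \<longleftrightarrow>
    weak_star_conv (\<lambda>k. empirical_measure (N k) (\<lambda>n. (S ^^ n) u)) \<kappa>"

text \<open>
  A joining is a measure on the Borel sets of the product space; on a compact metric space these
  form the product of the Borel sigma-algebras.
\<close>

definition self_joining2 ::
    "('a::topological_space \<Rightarrow> 'a) \<Rightarrow> 'a measure \<Rightarrow> ('a \<times> 'a) measure \<Rightarrow> bool" where
  "self_joining2 S \<kappa> \<Lambda> \<longleftrightarrow>
    invariant_prob (map_prod S S) \<Lambda> \<and> distr \<Lambda> borel fst = \<kappa> \<and> distr \<Lambda> borel snd = \<kappa>"

definition locally_orbital :: "(nat \<Rightarrow> nat) \<Rightarrow> (nat \<Rightarrow> nat \<Rightarrow> nat) \<Rightarrow> bool" where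
  "locally_orbital N \<phi> \<longleftrightarrow>
    (\<forall>k. \<phi> k permutes {1..N k}) \<and>
    (\<lambda>k. real (card {n \<in> {1..<N k}. \<phi> k (n + 1) = \<phi> k n + 1}) / real (N k)) \<longlonglongrightarrow> 1"

end

theory Submission
  imports Defs
begin

text \<open>
  The joining \<open>\<Lambda>\<close> is approximated at a fixed scale by finite combinatorial data, and the permutation
  translates long orbit segments of the first coordinate onto orbit segments of the second one.

  Fix a large \<open>L\<close>. Cover \<open>X\<close> by finitely many Bowen balls: points of one ball stay close to its centre
  for \<open>L\<close> steps. A subordinate continuous partition of unity \<open>g\<close> gives masses
  \<open>w c d = \<integral> g c x * g d y \<partial>\<Lambda>(x, y)\<close> to the pairs of centres. By invariance, the integral of a continuous
  \<open>F\<close> is close to the combination, with weights \<open>w c d\<close>, of the averages of \<open>F\<close> along the first \<open>L\<close>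
  points of the orbit of \<open>(c, d)\<close>. So it suffices to find disjoint blocks of length \<open>L\<close> that almost fill
  \<open>{1..N}\<close> and a permutation that translates blocks onto blocks, such that the proportion of blocks that
  follow the centre \<open>c\<close> and are sent to blocks that follow the centre \<open>d\<close> is about \<open>w c d\<close>. Such a permutation
  sends \<open>n + 1\<close> to \<open>\<phi> n + 1\<close> except at the ends of blocks and outside them, which is a small fraction of
  the times.

  The blocks of each coordinate are built separately, each with a name \<open>(c, d)\<close>. Both marginals of \<open>\<Lambda>\<close>
  are \<open>\<kappa>\<close> and the orbit of \<open>u\<close> has the statistics of \<open>\<kappa>\<close>, so a name drawn at a typical time, with
  probabilities prescribed by the conditional weights of \<open>w\<close>, is \<open>(c, d)\<close> with probability about \<open>w c d\<close>
  on either side; blocks of equal names are then matched. Block starts and names must inherit these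
  frequencies from the whole orbit. A tiling with a fixed phase modulo \<open>L\<close> can fail to do so, and therefore
  the phase varies from chunk to chunk. Both the phases and the names come from a greedy selection
  (\<open>greedy_balanced_selection\<close>) that takes the place of independent random choices; the outcome is
  \<open>eventually_exists_named_permutation\<close>. The resulting errors are uniform over test functions
  of given sup norm and oscillation (\<open>eventually_coupling_quality\<close>), and a diagonal choice of the scale
  finishes the proof.
\<close>

section \<open>Greedy selection\<close>

text \<open>
  A derandomised law of large numbers. If the options were drawn independently, the expected squared
  length of the total would be at most \<open>K\<close> times the number of draws, so some choice does as well.
  The induction finds it one draw at a time: the inner product of the total \<open>D\<close> so far with the
  next vector has mean zero, so some option of positive weight makes it nonpositive, and then the
  squared length grows by at most \<open>K\<close>.
\<close>

lemma greedy_balanced_selection: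
  fixes p :: "'c \<Rightarrow> 'r \<Rightarrow> real" and w :: "'c \<Rightarrow> 'r \<Rightarrow> 'z \<Rightarrow> real"
  assumes "finite C"
    and nonneg: "\<And>c r. c \<in> C \<Longrightarrow> r \<in> R \<Longrightarrow> 0 \<le> p c r"
    and total: "\<And>c. c \<in> C \<Longrightarrow> (\<Sum>r\<in>R. p c r) = 1"
    and mean: "\<And>c z. c \<in> C \<Longrightarrow> z \<in> Z \<Longrightarrow> (\<Sum>r\<in>R. p c r * w c r z) = 0"
    and bound: "\<And>c r. c \<in> C \<Longrightarrow> r \<in> R \<Longrightarrow> (\<Sum>z\<in>Z. (w c r z)\<^sup>2) \<le> K"
  shows "\<exists>\<rho>. (\<forall>c\<in>C. \<rho> c \<in> R \<and> 0 < p c (\<rho> c)) \<and>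
    (\<Sum>z\<in>Z. (\<Sum>c\<in>C. w c (\<rho> c) z)\<^sup>2) \<le> K * real (card C)"
  using assms
proof (induction C)
  case empty
  then show ?case by simp
next
  case (insert c C)
  have "\<exists>\<rho>. (\<forall>c\<in>C. \<rho> c \<in> R \<and> 0 < p c (\<rho> c)) \<and>
      (\<Sum>z\<in>Z. (\<Sum>c\<in>C. w c (\<rho> c) z)\<^sup>2) \<le> K * real (card C)"
    by (rule insert.IH) (use insert.prems in auto)
  then obtain \<rho> where \<rho>: "\<And>c. c \<in> C \<Longrightarrow> \<rho> c \<in> R \<and> 0 < p c (\<rho> c)"
    and dev: "(\<Sum>z\<in>Z. (\<Sum>c\<in>C. w c (\<rho> c) z)\<^sup>2) \<le> K * real (card C)"
    by auto
  define D where "D z = (\<Sum>c\<in>C. w c (\<rho> c) z)" for z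
  \<comment> \<open>Positivity of the weight matters: later the selected name must be one that the point supports.\<close>
  have "\<exists>r\<in>R. 0 < p c r \<and> (\<Sum>z\<in>Z. D z * w c r z) \<le> 0"
  proof (rule ccontr)
    assume "\<not> ?thesis"
    then have pos: "\<And>r. r \<in> R \<Longrightarrow> 0 < p c r \<Longrightarrow> 0 < (\<Sum>z\<in>Z. D z * w c r z)"
      by force
    have nn: "0 \<le> p c r" if "r \<in> R" for r
      using insert.prems(1) that by auto
    obtain r0 where r0: "r0 \<in> R" "0 < p c r0"
    proof -
      have "(\<Sum>r\<in>R. p c r) \<noteq> 0" using insert.prems(2) by simp
      then obtain r where "r \<in> R" "p c r \<noteq> 0" by (meson sum.neutral)
      then show ?thesis using that nn by force
    qed
    have finR: "finite R"
      using insert.prems(2)[of c] by (metis insertI1 sum.infinite zero_neq_one)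
    have "0 < (\<Sum>r\<in>R. p c r * (\<Sum>z\<in>Z. D z * w c r z))"
    proof (rule sum_pos2[OF finR r0(1)])
      show "0 < p c r0 * (\<Sum>z\<in>Z. D z * w c r0 z)" using pos r0 by simp
      show "0 \<le> p c r * (\<Sum>z\<in>Z. D z * w c r z)" if "r \<in> R" for r
        using pos[OF that] nn[OF that] by (cases "p c r = 0") auto
    qed
    also have "\<dots> = (\<Sum>z\<in>Z. D z * (\<Sum>r\<in>R. p c r * w c r z))"
      by (simp add: sum_distrib_left mult.left_commute) (rule sum.swap)
    also have "\<dots> = 0"
      using insert.prems(3) by simp
    finally show False by simp
  qed
  then obtain r where r: "r \<in> R" "0 < p c r" "(\<Sum>z\<in>Z. D z * w c r z) \<le> 0" by blast
  have "(\<Sum>z\<in>Z. (w c r z + D z)\<^sup>2)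
      = (\<Sum>z\<in>Z. (w c r z)\<^sup>2) + (\<Sum>z\<in>Z. (D z)\<^sup>2) + 2 * (\<Sum>z\<in>Z. D z * w c r z)"
    by (simp add: power2_sum sum.distrib sum_distrib_left algebra_simps)
  also have "\<dots> \<le> K + K * real (card C)"
    using r(1,3) dev insert.prems(4)[of c r] by (simp add: D_def)
  also have "\<dots> = K * real (card (insert c C))"
    using insert.hyps by (simp add: algebra_simps)
  finally have fin: "(\<Sum>z\<in>Z. (w c r z + D z)\<^sup>2) \<le> K * real (card (insert c C))" .
  define \<rho>' where "\<rho>' = \<rho>(c := r)"
  have \<rho>': "\<rho>' c = r" "\<And>c'. c' \<in> C \<Longrightarrow> \<rho>' c' = \<rho> c'"
    using insert.hyps by (auto simp: \<rho>'_def)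
  have "(\<Sum>c'\<in>insert c C. w c' (\<rho>' c') z) = w c r z + D z" for z
    using insert.hyps \<rho>' by (simp add: D_def cong: sum.cong)
  with fin r \<rho> \<rho>' show ?case
    by (intro exI[of _ \<rho>']) auto
qed

lemma sum_squares_le_imp_ge:
  fixes D :: "'z \<Rightarrow> real"
  assumes "finite Z" "z \<in> Z" "(\<Sum>z\<in>Z. (D z)\<^sup>2) \<le> s\<^sup>2" "0 \<le> s"
  shows "- s \<le> D z"
proof -
  have "(D z)\<^sup>2 \<le> (\<Sum>z\<in>Z. (D z)\<^sup>2)"
    using assms by (intro member_le_sum) auto
  then have "\<bar>D z\<bar> \<le> \<bar>s\<bar>"
    using assms(3) by (subst abs_le_square_iff) linarith
  then show ?thesis using assms(4) by linarith
qed

section \<open>Disjoint blocks with prescribed name frequencies\<close>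

text \<open>
  A start \<open>n\<close> stands for the block of times \<open>n, \<dots>, n + L - 1\<close>, hence the bound \<open>N + 1\<close>.
\<close>

definition block_starts :: "nat \<Rightarrow> nat \<Rightarrow> nat set \<Rightarrow> bool" where
  "block_starts L N B \<longleftrightarrow>
    (\<forall>n\<in>B. 1 \<le> n \<and> n + L \<le> N + 1) \<and> (\<forall>n\<in>B. \<forall>n'\<in>B. n < n' \<longrightarrow> n + L \<le> n')"

lemma block_starts_subset: "block_starts L N B \<Longrightarrow> B' \<subseteq> B \<Longrightarrow> block_starts L N B'"
  unfolding block_starts_def by blast

lemma block_starts_finite:
  assumes "block_starts L N B"
  shows "finite B"
proof (rule finite_subset)
  show "B \<subseteq> {..N + 1}"
  proof
    fix n assume "n \<in> B"
    then have "n + L \<le> N + 1" using assms unfolding block_starts_def by blast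
    then show "n \<in> {..N + 1}" by simp
  qed
qed simp

lemma block_starts_inj:
  assumes "block_starts L N B"
  shows "inj_on (\<lambda>(n, t). n + t) (B \<times> {..<L})"
proof (rule inj_onI, clarify)
  fix n t n' t'
  assume *: "n \<in> B" "n' \<in> B" "t < L" "t' < L" "n + t = n' + t'"
  have "n < n' \<Longrightarrow> n + L \<le> n'" "n' < n \<Longrightarrow> n' + L \<le> n"
    using assms * unfolding block_starts_def by blast+
  then show "n = n' \<and> t = t'" using * by linarith
qed

lemma block_starts_subset_interval:
  assumes "block_starts L N B"
  shows "(\<lambda>(n, t). n + t) ` (B \<times> {..<L}) \<subseteq> {1..N}"
proof (rule image_subsetI, clarify)
  fix n t assume "n \<in> B" "t < L"
  then have "1 \<le> n \<and> n + L \<le> N + 1" using assms unfolding block_starts_def by blast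
  then show "n + t \<in> {1..N}" using \<open>t < L\<close> by simp
qed

lemma block_starts_card:
  assumes "block_starts L N B"
  shows "card B * L \<le> N"
proof -
  have "card (B \<times> {..<L}) = card ((\<lambda>(n, t). n + t) ` (B \<times> {..<L}))"
    using block_starts_inj[OF assms] by (simp add: card_image)
  also have "\<dots> \<le> card {1..N}"
    using block_starts_subset_interval[OF assms] by (intro card_mono) auto
  finally show ?thesis by (simp add: card_cartesian_product)
qed

text \<open>
  Tiling \<open>{1..N}\<close> with blocks of length \<open>L\<close> at one fixed phase may see a biased sample of the
  orbit, for instance when the system has a factor that is a rotation of \<open>\<int>/L\<int>\<close>. So the time is
  cut into chunks of length \<open>L (Q + 1)\<close>, and each chunk selects its own phase \<open>r < L\<close>. Averaged over
  \<open>r\<close>, the \<open>Q\<close> blocks of a chunk sample each of its first \<open>L Q\<close> times with weight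
  \<open>1/L\<close>, and greedy selection realises this average up to a square-root error. The other two error
  terms are the last \<open>L\<close> times of each chunk and the incomplete chunk at the end.
\<close>

lemma exists_unbiased_offsets:
  fixes f :: "nat \<Rightarrow> 'z \<Rightarrow> real"
  assumes "0 < L" and "finite Z"
    and f0: "\<And>n z. 0 \<le> f n z" and f1: "\<And>n z. z \<in> Z \<Longrightarrow> f n z \<le> 1"
  shows "\<exists>B. block_starts L N B \<and>
    (\<forall>z\<in>Z. (\<Sum>n=1..N. f n z) - real N / real (Q + 1) - real (L * (Q + 1))
        - real (L * Q) * sqrt (real (card Z) * real N)
      \<le> real L * (\<Sum>n\<in>B. f n z))"
proof -
  define M where "M = L * (Q + 1)"
  define C where "C = N div M"
  have M0: "0 < M" using \<open>0 < L\<close> by (simp add: M_def)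
  have CM: "C * M \<le> N" by (simp add: C_def)
  have NC: "N < C * M + M" using M0 unfolding C_def
    by (metis add.commute div_mod_decomp mod_less_divisor nat_add_left_cancel_less)
  \<comment> \<open>The start of block \<open>q\<close> in chunk \<open>c\<close> at phase \<open>r\<close>; the final 1 is there because times begin at 1.\<close>
  define s where "s c r q = c * M + (q * L + r) + 1" for c r q :: nat
  define v where "v c r z = (\<Sum>q<Q. f (s c r q) z)" for c r z
  define \<mu> where "\<mu> c z = (\<Sum>r<L. v c r z) / real L" for c z
  have v0: "0 \<le> v c r z" for c r z unfolding v_def by (intro sum_nonneg f0)
  have v1: "v c r z \<le> real Q" if "z \<in> Z" for c r z
    unfolding v_def using sum_bounded_above[of "{..<Q}" "\<lambda>q. f (s c r q) z" 1] f1[OF that] by simp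
  have \<mu>0: "0 \<le> \<mu> c z" for c z unfolding \<mu>_def by (intro divide_nonneg_nonneg sum_nonneg v0) auto
  have \<mu>1: "\<mu> c z \<le> real Q" if "z \<in> Z" for c z
  proof -
    have "(\<Sum>r<L. v c r z) \<le> real L * real Q"
      using sum_bounded_above[of "{..<L}" "\<lambda>r. v c r z" "real Q"] v1[OF that] by simp
    then show ?thesis using \<open>0 < L\<close> by (simp add: \<mu>_def field_simps)
  qed
  have "\<exists>\<rho>. (\<forall>c\<in>{..<C}. \<rho> c \<in> {..<L} \<and> 0 < 1 / real L) \<and>
    (\<Sum>z\<in>Z. (\<Sum>c\<in>{..<C}. v c (\<rho> c) z - \<mu> c z)\<^sup>2) \<le> (real (card Z) * (real Q)\<^sup>2) * real (card {..<C})"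
  proof (rule greedy_balanced_selection)
    show "(\<Sum>r<L. 1 / real L) = 1" using \<open>0 < L\<close> by simp
    show "(\<Sum>r<L. 1 / real L * (v c r z - \<mu> c z)) = 0" for c z
      using \<open>0 < L\<close> by (simp add: sum_divide_distrib[symmetric] sum_subtractf \<mu>_def)
    show "(\<Sum>z\<in>Z. (v c r z - \<mu> c z)\<^sup>2) \<le> real (card Z) * (real Q)\<^sup>2" for c r
    proof (rule sum_bounded_above)
      fix z assume "z \<in> Z"
      have "\<bar>v c r z - \<mu> c z\<bar> \<le> \<bar>real Q\<bar>"
        using v0[of c r z] v1[OF \<open>z \<in> Z\<close>, of c r] \<mu>0[of c z] \<mu>1[OF \<open>z \<in> Z\<close>, of c] by linarith
      then show "(v c r z - \<mu> c z)\<^sup>2 \<le> (real Q)\<^sup>2"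
        by (simp only: abs_le_square_iff)
    qed
  qed auto
  then obtain \<rho> where \<rho>: "\<And>c. c < C \<Longrightarrow> \<rho> c < L"
    and dev: "(\<Sum>z\<in>Z. (\<Sum>c<C. v c (\<rho> c) z - \<mu> c z)\<^sup>2) \<le> real (card Z) * (real Q)\<^sup>2 * real C"
    by auto
  define st where "st = (\<lambda>(c, q). s c (\<rho> c) q)"
  define B where "B = st ` ({..<C} \<times> {..<Q})"
  have qL: "q * L + L \<le> Q * L" if "q < Q" for q
    using mult_le_mono1[of "Suc q" Q L] that by simp
  have cM: "c * M + M \<le> c' * M" if "c < c'" for c c'
    using mult_le_mono1[of "Suc c" c' M] that by simp
  have M': "M = Q * L + L" by (simp add: M_def algebra_simps)
  have sep1: "s c (\<rho> c) q + L \<le> c * M + M" if "c < C" "q < Q" for c q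
    using \<rho>[OF that(1)] qL[OF that(2)] unfolding s_def M' by linarith
  have sep2: "c * M < s c (\<rho> c) q" for c q
    unfolding s_def by linarith
  have sep: "s c (\<rho> c) q + L \<le> s c' (\<rho> c') q'"
    if "c < C" "q < Q" "c' < C" "q' < Q" "c < c' \<or> c = c' \<and> q < q'" for c q c' q'
    using that(5)
  proof
    assume "c < c'"
    then show ?thesis using sep1[OF that(1,2)] cM sep2[of c' q'] by (meson le_trans less_imp_le)
  next
    assume "c = c' \<and> q < q'"
    then show ?thesis using mult_le_mono1[of "Suc q" q' L] by (simp add: s_def)
  qed
  have starts: "block_starts L N B"
    unfolding block_starts_def
  proof (intro conjI ballI impI)
    fix n assume "n \<in> B"
    then obtain c q where n: "c < C" "q < Q" "n = s c (\<rho> c) q" by (auto simp: B_def st_def)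
    show "1 \<le> n" using n by (simp add: s_def)
    show "n + L \<le> N + 1" using sep1[OF n(1,2)] cM[OF n(1)] CM n(3) by linarith
  next
    fix n n' assume *: "n \<in> B" "n' \<in> B" "n < n'"
    obtain c q where n: "c < C" "q < Q" "n = s c (\<rho> c) q" using * by (auto simp: B_def st_def)
    obtain c' q' where n': "c' < C" "q' < Q" "n' = s c' (\<rho> c') q'" using * by (auto simp: B_def st_def)
    consider "c < c' \<or> c = c' \<and> q < q'" | "c' < c \<or> c' = c \<and> q' < q" | "c = c'" "q = q'"
      by linarith
    then show "n + L \<le> n'"
    proof cases
      case 1 then show ?thesis using sep n n' by blast
    next
      case 2 then have "n' + L \<le> n" using sep n n' by blast
      then show ?thesis using * by linarith
    next
      case 3 then show ?thesis using n n' * by simp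
    qed
  qed
  have inj: "inj_on st ({..<C} \<times> {..<Q})"
  proof (rule inj_onI, clarify)
    fix c q c' q' assume *: "c < C" "q < Q" "c' < C" "q' < Q" "st (c, q) = st (c', q')"
    have "\<not> (c < c' \<or> c = c' \<and> q < q')" "\<not> (c' < c \<or> c' = c \<and> q' < q)"
      using sep[of c q c' q'] sep[of c' q' c q] * \<open>0 < L\<close> by (auto simp: st_def)
    then show "c = c' \<and> q = q'" by linarith
  qed
  have "(\<Sum>n=1..N. f n z) - real N / real (Q + 1) - real (L * (Q + 1))
        - real (L * Q) * sqrt (real (card Z) * real N)
      \<le> real L * (\<Sum>n\<in>B. f n z)" if "z \<in> Z" for z
  proof -
    define g where "g n = f (n + 1) z" for n
    have g0: "0 \<le> g n" and g1: "g n \<le> 1" for n by (simp_all add: g_def f0 f1 that)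
    have sumB: "(\<Sum>n\<in>B. f n z) = (\<Sum>c<C. v c (\<rho> c) z)"
      unfolding B_def v_def
      by (subst sum.reindex[OF inj]) (simp add: sum.cartesian_product st_def case_prod_unfold)
    have "- (real Q * sqrt (real (card Z) * real N)) \<le> (\<Sum>c<C. v c (\<rho> c) z - \<mu> c z)"
    proof (rule sum_squares_le_imp_ge[OF \<open>finite Z\<close> that])
      have "C * 1 \<le> C * M" using M0 by (intro mult_le_mono2) simp
      then have "C \<le> N" using CM by linarith
      then have "real (card Z) * (real Q)\<^sup>2 * real C \<le> real (card Z) * (real Q)\<^sup>2 * real N"
        by (intro mult_left_mono) auto
      then show "(\<Sum>z\<in>Z. (\<Sum>c<C. v c (\<rho> c) z - \<mu> c z)\<^sup>2) \<le> (real Q * sqrt (real (card Z) * real N))\<^sup>2"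
        using dev by (simp add: power_mult_distrib mult_ac)
    qed auto
    then have A: "(\<Sum>c<C. \<mu> c z) - real Q * sqrt (real (card Z) * real N) \<le> (\<Sum>n\<in>B. f n z)"
      by (simp add: sumB sum_subtractf)
    have mu: "real L * \<mu> c z = sum g {c * M..<c * M + Q * L}" for c
    proof -
      have "real L * \<mu> c z = (\<Sum>q<Q. \<Sum>r<L. f (s c r q) z)"
        using \<open>0 < L\<close> by (simp add: \<mu>_def v_def) (rule sum.swap)
      also have "\<dots> = (\<Sum>q<Q. sum (\<lambda>t. g (c * M + t)) {q * L..<q * L + L})"
      proof (rule sum.cong[OF refl])
        fix q show "(\<Sum>r<L. f (s c r q) z) = sum (\<lambda>t. g (c * M + t)) {q * L..<q * L + L}"
          by (rule sum.reindex_bij_witness[of _ "\<lambda>t. t - q * L" "\<lambda>r. q * L + r"])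
             (auto simp: g_def s_def)
      qed
      also have "\<dots> = sum (\<lambda>t. g (c * M + t)) {..<Q * L}" by (rule sum.nat_group)
      also have "\<dots> = sum g {c * M..<c * M + Q * L}"
        by (rule sum.reindex_bij_witness[of _ "\<lambda>t. t - c * M" "\<lambda>r. c * M + r"]) auto
      finally show ?thesis .
    qed
    have chunk: "sum g {c * M..<c * M + M} \<le> real L * \<mu> c z + real L" for c
    proof -
      have "sum g {c * M..<c * M + M} = sum g {c * M..<c * M + Q * L} + sum g {c * M + Q * L..<c * M + M}"
        by (rule sum.atLeastLessThan_concat[symmetric]) (auto simp: M')
      moreover have "sum g {c * M + Q * L..<c * M + M} \<le> real L"
        using sum_bounded_above[of "{c * M + Q * L..<c * M + M}" g 1] g1 by (simp add: M')
      ultimately show ?thesis using mu by simp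
    qed
    have "(\<Sum>n=1..N. f n z) = sum g {0..<N}"
      by (rule sum.reindex_bij_witness[of _ "\<lambda>t. t + 1" "\<lambda>r. r - 1"]) (auto simp: g_def)
    also have "\<dots> = sum g {0..<C * M} + sum g {C * M..<N}"
      by (rule sum.atLeastLessThan_concat[symmetric]) (auto simp: CM)
    also have "sum g {0..<C * M} = (\<Sum>c<C. sum g {c * M..<c * M + M})"
      by (simp add: sum.nat_group atLeast0LessThan)
    also have "\<dots> \<le> (\<Sum>c<C. real L * \<mu> c z + real L)" by (intro sum_mono chunk)
    also have "\<dots> = real L * (\<Sum>c<C. \<mu> c z) + real C * real L"
      by (simp add: sum.distrib sum_distrib_left)
    also have "sum g {C * M..<N} \<le> real M"
    proof -
      have "sum g {C * M..<N} \<le> real (N - C * M)"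
        using sum_bounded_above[of "{C * M..<N}" g 1] g1 by simp
      then show ?thesis using NC by linarith
    qed
    also have "real C * real L \<le> real N / real (Q + 1)"
    proof -
      have "C * L * (Q + 1) \<le> N" using CM by (simp only: M_def mult.assoc)
      then have "real (C * L * (Q + 1)) \<le> real N" by linarith
      then show ?thesis by (simp add: field_simps)
    qed
    finally have "(\<Sum>n=1..N. f n z) - real N / real (Q + 1) - real M \<le> real L * (\<Sum>c<C. \<mu> c z)"
      by simp
    moreover have "real L * ((\<Sum>c<C. \<mu> c z) - real Q * sqrt (real (card Z) * real N)) \<le> real L * (\<Sum>n\<in>B. f n z)"
      using A by (intro mult_left_mono) auto
    ultimately show ?thesis
      by (simp add: M_def algebra_simps)
  qed
  with starts show ?thesis by blast
qed

text \<open>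
  The same rounding argument at the level of single blocks: a block start \<open>n\<close> draws the name \<open>z\<close> with
  weight \<open>f n z\<close>, and the drawn vector is the indicator of the name minus its mean.
\<close>

lemma exists_unbiased_names:
  fixes f :: "nat \<Rightarrow> 'z \<Rightarrow> real"
  assumes "finite B" and "finite Z"
    and f0: "\<And>n z. 0 \<le> f n z" and f1: "\<And>n. (\<Sum>z\<in>Z. f n z) = 1"
  shows "\<exists>a. (\<forall>n\<in>B. a n \<in> Z \<and> 0 < f n (a n)) \<and>
    (\<forall>z\<in>Z. (\<Sum>n\<in>B. f n z) - sqrt (real (card Z) * real (card B)) \<le> real (card {n \<in> B. a n = z}))"
proof -
  have le1: "f n z \<le> 1" if "z \<in> Z" for n z
    using member_le_sum[OF that, of "f n"] f0 f1 \<open>finite Z\<close> by simp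
  have "\<exists>a. (\<forall>n\<in>B. a n \<in> Z \<and> 0 < f n (a n)) \<and>
    (\<Sum>z\<in>Z. (\<Sum>n\<in>B. of_bool (a n = z) - f n z)\<^sup>2) \<le> real (card Z) * real (card B)"
  proof (rule greedy_balanced_selection[OF \<open>finite B\<close>])
    show "(\<Sum>x\<in>Z. f n x * (of_bool (x = z) - f n z)) = 0" if "z \<in> Z" for n z
    proof -
      have "(\<Sum>x\<in>Z. f n x * (of_bool (x = z) - f n z))
          = (\<Sum>x\<in>Z. if x = z then f n x else 0) - (\<Sum>x\<in>Z. f n x) * f n z"
        unfolding sum_distrib_right sum_subtractf[symmetric]
        by (intro sum.cong) (auto simp: algebra_simps)
      then show ?thesis using that \<open>finite Z\<close> f1 by simp
    qed
    show "(\<Sum>z\<in>Z. (of_bool (x = z) - f n z)\<^sup>2) \<le> real (card Z)" for n x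
    proof -
      have "(\<Sum>z\<in>Z. (of_bool (x = z) - f n z)\<^sup>2) \<le> of_nat (card Z) * (1::real)"
      proof (rule sum_bounded_above)
        fix z assume "z \<in> Z"
        have "\<bar>of_bool (x = z) - f n z\<bar> \<le> 1" using f0[of n z] le1[OF \<open>z \<in> Z\<close>, of n] by auto
        then show "(of_bool (x = z) - f n z)\<^sup>2 \<le> 1" by (simp add: abs_square_le_1)
      qed
      then show ?thesis by simp
    qed
  qed (use f0 f1 in auto)
  then obtain a where a: "\<forall>n\<in>B. a n \<in> Z \<and> 0 < f n (a n)"
    and dev: "(\<Sum>z\<in>Z. (\<Sum>n\<in>B. of_bool (a n = z) - f n z)\<^sup>2) \<le> real (card Z) * real (card B)"
    by auto
  have "(\<Sum>n\<in>B. f n z) - sqrt (real (card Z) * real (card B)) \<le> real (card {n \<in> B. a n = z})"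
    if "z \<in> Z" for z
  proof -
    have "- sqrt (real (card Z) * real (card B)) \<le> (\<Sum>n\<in>B. of_bool (a n = z) - f n z)"
      using dev by (intro sum_squares_le_imp_ge[OF \<open>finite Z\<close> that]) auto
    also have "\<dots> = real (card {n \<in> B. a n = z}) - (\<Sum>n\<in>B. f n z)"
      using \<open>finite B\<close> by (simp add: sum_subtractf sum.If_cases of_bool_def Int_def)
    finally show ?thesis by simp
  qed
  with a show ?thesis by blast
qed

text \<open>
  The two roundings together: phases first, then names. The number \<open>Q\<close> of blocks in a chunk is fixed
  in advance to make the losses inside the chunks small; what remains is of order \<open>sqrt N\<close>.
\<close>

lemma eventually_exists_named_blocks:
  fixes f :: "nat \<Rightarrow> 'z \<Rightarrow> real" and \<epsilon> :: real
  assumes "0 < L" and "finite Z" and "0 < \<epsilon>"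
    and f0: "\<And>n z. 0 \<le> f n z" and f1: "\<And>n. (\<Sum>z\<in>Z. f n z) = 1"
  shows "\<forall>\<^sub>F N in sequentially. \<exists>B a. block_starts L N B \<and> (\<forall>n\<in>B. a n \<in> Z \<and> 0 < f n (a n)) \<and>
      (\<forall>z\<in>Z. (\<Sum>n=1..N. f n z) - \<epsilon> * real N \<le> real L * real (card {n \<in> B. a n = z}))"
proof -
  obtain Q :: nat where "inverse (real (Suc Q)) < \<epsilon> / 2"
    using reals_Archimedean[OF half_gt_zero[OF \<open>0 < \<epsilon>\<close>]] by blast
  then have Q: "1 / real (Q + 1) < \<epsilon> / 2"
    by (simp only: inverse_eq_divide Suc_eq_plus1)
  have small: "\<forall>\<^sub>F N in sequentially. real (L * (Q + 1)) + real (L * Q + L) * sqrt (real (card Z) * real N)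
      \<le> \<epsilon> / 2 * real N"
  proof -
    have "(\<lambda>N. real (L * (Q + 1)) / real N + real (L * Q + L) * sqrt (real (card Z)) * (1 / sqrt (real N)))
        \<longlonglongrightarrow> 0 + real (L * Q + L) * sqrt (real (card Z)) * 0"
      by (intro tendsto_intros tendsto_divide_0[OF tendsto_const] filterlim_at_top_imp_at_infinity
          filterlim_compose[OF sqrt_at_top] filterlim_real_sequentially)
    then have "\<forall>\<^sub>F N in sequentially. real (L * (Q + 1)) / real N + real (L * Q + L) * sqrt (real (card Z)) * (1 / sqrt (real N)) < \<epsilon> / 2"
      using \<open>0 < \<epsilon>\<close> by (intro order_tendstoD) auto
    moreover have "\<forall>\<^sub>F N in sequentially. 0 < (N::nat)" by (rule eventually_gt_at_top)
    ultimately show ?thesis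
    proof eventually_elim
      case (elim N)
      have "real (L * (Q + 1)) + real (L * Q + L) * sqrt (real (card Z) * real N)
        = (real (L * (Q + 1)) / real N + real (L * Q + L) * sqrt (real (card Z)) * (1 / sqrt (real N))) * real N"
      proof -
        have "A + B * (k * s) = (A / (s * s) + B * k * (1 / s)) * (s * s)" if "0 < s" for A B k s :: real
          using that by (simp add: field_simps)
        from this[of "sqrt (real N)"] show ?thesis
          using elim by (simp add: real_sqrt_mult)
      qed
      also have "\<dots> \<le> \<epsilon> / 2 * real N"
        using elim by (intro mult_right_mono) auto
      finally show ?case .
    qed
  qed
  have le1: "f n z \<le> 1" if "z \<in> Z" for n z
    using member_le_sum[OF that, of "f n"] f0 f1 \<open>finite Z\<close> by simp
  from small show ?thesis
  proof eventually_elim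
    case (elim N)
    obtain B where B: "block_starts L N B" and
      sumB: "\<And>z. z \<in> Z \<Longrightarrow> (\<Sum>n=1..N. f n z) - real N / real (Q + 1) - real (L * (Q + 1))
        - real (L * Q) * sqrt (real (card Z) * real N) \<le> real L * (\<Sum>n\<in>B. f n z)"
      using exists_unbiased_offsets[OF \<open>0 < L\<close> \<open>finite Z\<close>, of f N Q] f0 le1 by blast
    obtain a where a: "\<forall>n\<in>B. a n \<in> Z \<and> 0 < f n (a n)" and
      card: "\<And>z. z \<in> Z \<Longrightarrow> (\<Sum>n\<in>B. f n z) - sqrt (real (card Z) * real (card B)) \<le> real (card {n \<in> B. a n = z})"
      using exists_unbiased_names[OF block_starts_finite[OF B] \<open>finite Z\<close>, of f] f0 f1 by auto
    have "(\<Sum>n=1..N. f n z) - \<epsilon> * real N \<le> real L * real (card {n \<in> B. a n = z})" if "z \<in> Z" for z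
    proof -
      have "card B * 1 \<le> card B * L" using \<open>0 < L\<close> by (intro mult_le_mono2) simp
      then have "card B \<le> N" using block_starts_card[OF B] by linarith
      then have "sqrt (real (card Z) * real (card B)) \<le> sqrt (real (card Z) * real N)"
        by (intro real_sqrt_le_mono mult_left_mono) auto
      then have "real L * ((\<Sum>n\<in>B. f n z) - sqrt (real (card Z) * real N)) \<le> real L * real (card {n \<in> B. a n = z})"
        using card[OF that] by (intro mult_left_mono) (linarith, simp)
      moreover have "real N / real (Q + 1) \<le> \<epsilon> / 2 * real N"
        using mult_right_mono[OF less_imp_le[OF Q], of "real N"] by simp
      ultimately show ?thesis using sumB[OF that] elim
        unfolding right_diff_distrib of_nat_add distrib_right by linarith
    qed
    with B a show ?case by blast
  qed
qed


section \<open>Matching blocks of equal names\<close>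

lemma exists_partial_bijection:
  assumes "finite A" and "finite A'"
  shows "\<exists>T \<sigma>. T \<subseteq> A \<and> inj_on \<sigma> T \<and> \<sigma> ` T \<subseteq> A' \<and> card T = min (card A) (card A')"
proof -
  obtain T where T: "T \<subseteq> A" "card T = min (card A) (card A')" "finite T"
    using obtain_subset_with_card_n[of "min (card A) (card A')" A] by auto
  then obtain \<sigma> where "\<sigma> ` T \<subseteq> A'" "inj_on \<sigma> T"
    using card_le_inj[OF T(3) assms(2)] by auto
  with T show ?thesis by blast
qed

lemma exists_name_preserving_matching:
  fixes a :: "'n \<Rightarrow> 'z" and a' :: "'m \<Rightarrow> 'z"
  assumes "finite B" and "finite B'"
  shows "\<exists>B0 \<sigma>. B0 \<subseteq> B \<and> inj_on \<sigma> B0 \<and> \<sigma> ` B0 \<subseteq> B' \<and> (\<forall>n\<in>B0. a' (\<sigma> n) = a n) \<and>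
    (\<forall>z. card {n \<in> B0. a n = z} = min (card {n \<in> B. a n = z}) (card {n \<in> B'. a' n = z}))"
proof -
  have "\<exists>T \<sigma>. T \<subseteq> {n \<in> B. a n = z} \<and> inj_on \<sigma> T \<and> \<sigma> ` T \<subseteq> {n \<in> B'. a' n = z} \<and>
      card T = min (card {n \<in> B. a n = z}) (card {n \<in> B'. a' n = z})" for z
    by (rule exists_partial_bijection) (use assms in auto)
  then have "\<forall>z. \<exists>p. fst p \<subseteq> {n \<in> B. a n = z} \<and> inj_on (snd p) (fst p) \<and>
      snd p ` fst p \<subseteq> {n \<in> B'. a' n = z} \<and>
      card (fst p) = min (card {n \<in> B. a n = z}) (card {n \<in> B'. a' n = z})"
    by simp
  then obtain p where p: "\<forall>z. fst (p z) \<subseteq> {n \<in> B. a n = z} \<and> inj_on (snd (p z)) (fst (p z)) \<and>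
      snd (p z) ` fst (p z) \<subseteq> {n \<in> B'. a' n = z} \<and>
      card (fst (p z)) = min (card {n \<in> B. a n = z}) (card {n \<in> B'. a' n = z})"
    unfolding choice_iff by (elim exE)
  define T where "T z = fst (p z)" for z
  define \<sigma> where "\<sigma> z = snd (p z)" for z
  have T: "T z \<subseteq> {n \<in> B. a n = z}" and inj: "inj_on (\<sigma> z) (T z)"
    and im: "\<sigma> z ` T z \<subseteq> {n \<in> B'. a' n = z}"
    and card: "card (T z) = min (card {n \<in> B. a n = z}) (card {n \<in> B'. a' n = z})" for z
    using p unfolding T_def \<sigma>_def by simp_all
  define B0 where "B0 = {n \<in> B. n \<in> T (a n)}"
  define s where "s n = \<sigma> (a n) n" for n
  have s: "s n \<in> B' \<and> a' (s n) = a n" if "n \<in> B0" for n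
    using im[of "a n"] that unfolding B0_def s_def by blast
  have "inj_on s B0"
  proof (rule inj_onI)
    fix n n' assume *: "n \<in> B0" "n' \<in> B0" "s n = s n'"
    then have "a n = a n'" using s by metis
    then show "n = n'" using * inj[of "a n"] by (auto simp: B0_def s_def inj_on_def)
  qed
  moreover have "{n \<in> B0. a n = z} = T z" for z
    using T unfolding B0_def by blast
  ultimately show ?thesis
    using s card by (intro exI[of _ B0] exI[of _ s]) (auto simp: B0_def)
qed

lemma partial_injection_extends_to_permutation:
  assumes "finite A" and "W \<subseteq> A" and inj: "inj_on g W" and "g ` W \<subseteq> A"
  shows "\<exists>\<phi>. \<phi> permutes A \<and> (\<forall>n\<in>W. \<phi> n = g n)"
proof -
  have "card (A - W) = card (A - g ` W)"
    using assms by (simp add: card_Diff_subset finite_subset card_image)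
  then obtain h where h: "bij_betw h (A - W) (A - g ` W)"
    using \<open>finite A\<close> by (metis finite_Diff finite_same_card_bij)
  define \<phi> where "\<phi> n = (if n \<in> W then g n else if n \<in> A then h n else n)" for n
  have "bij_betw \<phi> W (g ` W)"
    using inj by (auto simp: \<phi>_def bij_betw_def inj_on_def)
  moreover have "bij_betw \<phi> (A - W) (A - g ` W)"
    using h by (subst bij_betw_cong[of _ _ h]) (auto simp: \<phi>_def)
  ultimately have "bij_betw \<phi> (W \<union> (A - W)) (g ` W \<union> (A - g ` W))"
    by (rule bij_betw_combine) auto
  moreover have "W \<union> (A - W) = A" "g ` W \<union> (A - g ` W) = A" using assms by auto
  ultimately have "\<phi> permutes A"
    using \<open>W \<subseteq> A\<close> by (intro bij_imp_permutes) (auto simp: \<phi>_def)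
  then show ?thesis by (auto simp: \<phi>_def)
qed

text \<open>
  Matched blocks are carried onto each other by a translation; the uncovered times are mapped
  bijectively in any way.
\<close>

lemma block_matching_extends_to_permutation:
  assumes B: "block_starts L N B" and B': "block_starts L N B'"
    and \<sigma>: "inj_on \<sigma> B" "\<sigma> ` B \<subseteq> B'" and "0 < L"
  shows "\<exists>\<phi>. \<phi> permutes {1..N} \<and> (\<forall>n\<in>B. \<forall>t<L. \<phi> (n + t) = \<sigma> n + t)"
proof -
  define P where "P = (\<lambda>(n::nat, t::nat). n + t)"
  define D where "D = B \<times> {..<L}"
  define \<tau> where "\<tau> = (\<lambda>(n, t::nat). (\<sigma> n, t))"
  define g where "g = P \<circ> \<tau> \<circ> the_inv_into D P"
  have injP: "inj_on P D" using block_starts_inj[OF B] by (simp add: P_def D_def)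
  have g: "g (P d) = P (\<tau> d)" if "d \<in> D" for d
    using the_inv_into_f_f[OF injP that] by (simp add: g_def)
  have \<tau>D: "\<tau> ` D \<subseteq> B' \<times> {..<L}" using \<sigma>(2) by (auto simp: \<tau>_def D_def)
  have "inj_on \<tau> D" using \<sigma>(1) by (auto simp: inj_on_def \<tau>_def D_def)
  then have "inj_on (P \<circ> \<tau>) D"
    using inj_on_subset[OF block_starts_inj[OF B'] \<tau>D] by (intro comp_inj_on) (auto simp: P_def)
  then have "inj_on g (P ` D)"
    unfolding inj_on_def using g by fastforce
  moreover have "g ` P ` D \<subseteq> {1..N}"
  proof -
    have "g ` P ` D = P ` \<tau> ` D" using g by (auto simp: image_image)
    also have "\<dots> \<subseteq> P ` (B' \<times> {..<L})" using \<tau>D by (rule image_mono)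
    finally show ?thesis using block_starts_subset_interval[OF B'] by (auto simp: P_def)
  qed
  moreover have "P ` D \<subseteq> {1..N}"
    using block_starts_subset_interval[OF B] by (simp add: P_def D_def)
  ultimately obtain \<phi> where \<phi>: "\<phi> permutes {1..N}" "\<forall>n\<in>P ` D. \<phi> n = g n"
    using partial_injection_extends_to_permutation[of "{1..N}" "P ` D" g] by auto
  have "\<phi> (n + t) = \<sigma> n + t" if "n \<in> B" "t < L" for n t
    using \<phi>(2) g[of "(n, t)"] that by (force simp: D_def P_def \<tau>_def)
  with \<phi>(1) show ?thesis by blast
qed

text \<open>
  The two weight systems stand for the two coordinates of a joining. In that case both give a name \<open>z\<close>
  about the same total weight, and the smaller of the two totals governs how many blocks can be matched.
  After the matching the name of a block records information on the orbit
  at \<open>n\<close> through \<open>f\<close> and on the orbit at \<open>\<phi> n\<close> through \<open>f'\<close>.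
\<close>

lemma eventually_exists_named_permutation:
  fixes f f' :: "nat \<Rightarrow> 'z \<Rightarrow> real" and \<epsilon> :: real
  assumes "0 < L" and "finite Z" and "0 < \<epsilon>"
    and f: "\<And>n z. 0 \<le> f n z" "\<And>n. (\<Sum>z\<in>Z. f n z) = 1"
    and f': "\<And>n z. 0 \<le> f' n z" "\<And>n. (\<Sum>z\<in>Z. f' n z) = 1"
  shows "\<forall>\<^sub>F N in sequentially. \<exists>\<phi> B a. \<phi> permutes {1..N} \<and> block_starts L N B \<and>
      (\<forall>n\<in>B. \<forall>t<L. \<phi> (n + t) = \<phi> n + t) \<and>
      (\<forall>n\<in>B. a n \<in> Z \<and> 0 < f n (a n) \<and> 0 < f' (\<phi> n) (a n)) \<and>
      (\<forall>z\<in>Z. min (\<Sum>n=1..N. f n z) (\<Sum>n=1..N. f' n z) - \<epsilon> * real N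
        \<le> real L * real (card {n \<in> B. a n = z}))"
  using eventually_exists_named_blocks[where f = f, OF assms(1-3) f]
    eventually_exists_named_blocks[where f = f', OF assms(1-3) f']
proof eventually_elim
  case (elim N)
  obtain B a where B: "block_starts L N B" "\<And>n. n \<in> B \<Longrightarrow> a n \<in> Z \<and> 0 < f n (a n)"
    and cardB: "\<And>z. z \<in> Z \<Longrightarrow> (\<Sum>n=1..N. f n z) - \<epsilon> * real N \<le> real L * real (card {n \<in> B. a n = z})"
    using elim(1) by auto
  obtain B' a' where B': "block_starts L N B'" "\<And>n. n \<in> B' \<Longrightarrow> a' n \<in> Z \<and> 0 < f' n (a' n)"
    and cardB': "\<And>z. z \<in> Z \<Longrightarrow> (\<Sum>n=1..N. f' n z) - \<epsilon> * real N \<le> real L * real (card {n \<in> B'. a' n = z})"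
    using elim(2) by auto
  obtain B0 \<sigma> where B0: "B0 \<subseteq> B" "inj_on \<sigma> B0" "\<sigma> ` B0 \<subseteq> B'" "\<And>n. n \<in> B0 \<Longrightarrow> a' (\<sigma> n) = a n"
    and card: "\<And>z. card {n \<in> B0. a n = z} = min (card {n \<in> B. a n = z}) (card {n \<in> B'. a' n = z})"
    using exists_name_preserving_matching[OF block_starts_finite[OF B(1)] block_starts_finite[OF B'(1)],
        where a = a and a' = a']
    by auto
  note starts = block_starts_subset[OF B(1) B0(1)]
  obtain \<phi> where \<phi>: "\<phi> permutes {1..N}" "\<And>n t. n \<in> B0 \<Longrightarrow> t < L \<Longrightarrow> \<phi> (n + t) = \<sigma> n + t"
    using block_matching_extends_to_permutation[OF starts B'(1) B0(2,3) \<open>0 < L\<close>] by auto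
  have \<phi>0: "\<phi> n = \<sigma> n" if "n \<in> B0" for n
    using \<phi>(2)[OF that \<open>0 < L\<close>] by simp
  have "a n \<in> Z \<and> 0 < f n (a n) \<and> 0 < f' (\<phi> n) (a n)" if "n \<in> B0" for n
    using B(2)[of n] B'(2)[of "\<sigma> n"] B0(1,3) B0(4)[OF that] \<phi>0[OF that] that by auto
  moreover have "min (\<Sum>n=1..N. f n z) (\<Sum>n=1..N. f' n z) - \<epsilon> * real N
      \<le> real L * real (card {n \<in> B0. a n = z})" if "z \<in> Z" for z
    using cardB[OF that] cardB'[OF that] unfolding card by (simp add: min_def split: if_splits)
  ultimately show ?case
    using starts \<phi> \<phi>0 by (intro exI[of _ \<phi>] exI[of _ B0] exI[of _ a]) simp
qed

section \<open>Averages over named blocks\<close>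

lemma sum_named_blocks:
  fixes h :: "'z \<Rightarrow> real"
  assumes "finite B" and "finite Z" and a: "\<And>n. n \<in> B \<Longrightarrow> a n \<in> Z"
  shows "(\<Sum>n\<in>B. h (a n)) = (\<Sum>z\<in>Z. real (card {n \<in> B. a n = z}) * h z)"
proof -
  have "(\<Sum>n\<in>B. h (a n)) = (\<Sum>z\<in>Z. \<Sum>n\<in>{n \<in> B. a n = z}. h (a n))"
    using assms by (intro sum.group[symmetric]) auto
  also have "\<dots> = (\<Sum>z\<in>Z. real (card {n \<in> B. a n = z}) * h z)"
    by (intro sum.cong refl) simp
  finally show ?thesis .
qed

text \<open>
  Lower bounds on all name counts suffice, because the target frequencies \<open>m\<close> already add up to 1:
  summed over the names, they bound the covered part of \<open>{1..N}\<close> from below.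
\<close>

lemma named_blocks_cover:
  fixes m :: "'z \<Rightarrow> real"
  assumes "finite B" and "finite Z" and a: "\<And>n. n \<in> B \<Longrightarrow> a n \<in> Z"
    and m1: "(\<Sum>z\<in>Z. m z) = 1"
    and freq: "\<And>z. z \<in> Z \<Longrightarrow> real N * m z - \<delta> * real N \<le> real L * real (card {n \<in> B. a n = z})"
  shows "real N - real N * (real (card Z) * \<delta>) \<le> real L * real (card B)"
proof -
  have "(\<Sum>z\<in>Z. real N * m z - \<delta> * real N) \<le> (\<Sum>z\<in>Z. real L * real (card {n \<in> B. a n = z}))"
    using freq by (intro sum_mono)
  moreover have "real (card B) = (\<Sum>z\<in>Z. real (card {n \<in> B. a n = z}))"
    using sum_named_blocks[OF assms(1-3), where h = "\<lambda>_. 1"] by simp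
  ultimately show ?thesis
    by (simp add: sum_subtractf m1 sum_distrib_left[symmetric] algebra_simps)
qed

lemma sum_blocks:
  fixes G :: "nat \<Rightarrow> real"
  assumes "block_starts L N B"
  shows "(\<Sum>n\<in>B. \<Sum>t<L. G (n + t)) = sum G ((\<lambda>(n, t). n + t) ` (B \<times> {..<L}))"
  by (subst sum.reindex[OF block_starts_inj[OF assms]])
     (simp add: sum.cartesian_product case_prod_unfold)

text \<open>
  With \<open>\<beta> = card Z * \<delta>\<close>, the error per time unit has three sources: times outside the blocks (\<open>b \<beta>\<close>),
  replacing a block sum by the value \<open>H\<close> of its name (\<open>\<eta>\<close>), and replacing the name frequencies by \<open>m\<close>
  (\<open>2 b \<beta>\<close>).
\<close>

lemma named_blocks_sum_estimate:
  fixes G :: "nat \<Rightarrow> real" and H m :: "'z \<Rightarrow> real"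
  assumes B: "block_starts L N B" and "0 < L" and "finite Z"
    and a: "\<And>n. n \<in> B \<Longrightarrow> a n \<in> Z"
    and m1: "(\<Sum>z\<in>Z. m z) = 1"
    and freq: "\<And>z. z \<in> Z \<Longrightarrow> real N * m z - \<delta> * real N \<le> real L * real (card {n \<in> B. a n = z})"
    and G: "\<And>n. \<bar>G n\<bar> \<le> b" and H: "\<And>z. \<bar>H z\<bar> \<le> real L * b"
    and near: "\<And>n. n \<in> B \<Longrightarrow> \<bar>(\<Sum>t<L. G (n + t)) - H (a n)\<bar> \<le> real L * \<eta>"
    and "0 \<le> \<eta>"
  shows "\<bar>(\<Sum>n=1..N. G n) - real N * ((\<Sum>z\<in>Z. m z * H z) / real L)\<bar>
    \<le> real N * (\<eta> + 3 * b * (real (card Z) * \<delta>))"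
proof -
  define K where "K z = card {n \<in> B. a n = z}" for z
  define W where "W = (\<lambda>(n, t). n + t) ` (B \<times> {..<L})"
  have b0: "0 \<le> b" using G[of 0] by linarith
  have finB: "finite B" using B by (rule block_starts_finite)
  have LB: "real L * real (card B) \<le> real N"
    using block_starts_card[OF B] by (metis mult.commute of_nat_le_iff of_nat_mult)
  have by_name: "(\<Sum>n\<in>B. h (a n)) = (\<Sum>z\<in>Z. real (K z) * h z)" for h :: "'z \<Rightarrow> real"
    unfolding K_def using finB \<open>finite Z\<close> a by (rule sum_named_blocks)
  have cardB: "real (card B) = (\<Sum>z\<in>Z. real (K z))" using by_name[of "\<lambda>_. 1"] by simp
  have covered: "real N - real L * real (card B) \<le> real N * (real (card Z) * \<delta>)"
    using named_blocks_cover[OF finB \<open>finite Z\<close> a m1 freq] by linarith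
  have W: "W \<subseteq> {1..N}" using block_starts_subset_interval[OF B] by (simp add: W_def)
  have "card W = card B * L"
    unfolding W_def by (subst card_image[OF block_starts_inj[OF B]]) (simp add: card_cartesian_product)
  then have "card ({1..N} - W) = N - card B * L" using W by (simp add: card_Diff_subset finite_subset)
  then have rest: "real (card ({1..N} - W)) = real N - real L * real (card B)"
    using block_starts_card[OF B] by (simp add: of_nat_diff)
  have "\<bar>(\<Sum>n=1..N. G n) - (\<Sum>n\<in>B. \<Sum>t<L. G (n + t))\<bar> = \<bar>sum G ({1..N} - W)\<bar>"
    using W by (simp add: sum_blocks[OF B] W_def[symmetric] sum_diff)
  also have "\<dots> \<le> (\<Sum>n\<in>{1..N} - W. b)"
    using G by (intro order.trans[OF sum_abs] sum_mono)
  also have "\<dots> \<le> real N * (b * (real (card Z) * \<delta>))"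
    using mult_right_mono[OF covered b0] by (simp only: sum_constant rest mult_ac)
  finally have 1: "\<bar>(\<Sum>n=1..N. G n) - (\<Sum>n\<in>B. \<Sum>t<L. G (n + t))\<bar>
    \<le> real N * (b * (real (card Z) * \<delta>))" .
  have "\<bar>(\<Sum>n\<in>B. \<Sum>t<L. G (n + t)) - (\<Sum>n\<in>B. H (a n))\<bar> \<le> (\<Sum>n\<in>B. real L * \<eta>)"
    unfolding sum_subtractf[symmetric] using near by (intro order.trans[OF sum_abs] sum_mono)
  also have "\<dots> \<le> real N * \<eta>"
    using mult_right_mono[OF LB \<open>0 \<le> \<eta>\<close>] by (simp add: mult_ac)
  finally have 2: "\<bar>(\<Sum>n\<in>B. \<Sum>t<L. G (n + t)) - (\<Sum>n\<in>B. H (a n))\<bar> \<le> real N * \<eta>" .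
  define x where "x z = real L * real (K z) - real N * m z" for z
  \<comment> \<open>The deviations \<open>x z\<close> have nonpositive sum and are at least \<open>- \<delta> N\<close>; this bounds the sum of
    their absolute values by \<open>2 card Z \<delta> N\<close>.\<close>
  have sumx: "(\<Sum>z\<in>Z. x z) \<le> 0"
    using LB by (simp add: x_def sum_subtractf sum_distrib_left[symmetric] cardB[symmetric] m1)
  have L: "0 < real L" using \<open>0 < L\<close> by simp
  have "(\<Sum>n\<in>B. H (a n)) - real N * ((\<Sum>z\<in>Z. m z * H z) / real L) = (\<Sum>z\<in>Z. x z * (H z / real L))"
    using L by (simp add: by_name x_def sum_divide_distrib sum_distrib_left sum_subtractf[symmetric] field_simps)
  also have "\<bar>\<dots>\<bar> \<le> (\<Sum>z\<in>Z. (x z + 2 * (\<delta> * real N)) * b)"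
  proof (intro order.trans[OF sum_abs] sum_mono)
    fix z assume "z \<in> Z"
    have x: "- (\<delta> * real N) \<le> x z" using freq[OF \<open>z \<in> Z\<close>] by (simp add: x_def K_def)
    have "0 \<le> real N * (real (card Z) * \<delta>)" using covered LB by linarith
    moreover have "0 < card Z" using \<open>z \<in> Z\<close> \<open>finite Z\<close> by (auto simp: card_gt_0_iff)
    ultimately have "0 \<le> \<delta> * real N" by (simp add: zero_le_mult_iff) auto
    then have "\<bar>x z\<bar> \<le> x z + 2 * (\<delta> * real N)" using x by linarith
    moreover have "\<bar>H z / real L\<bar> \<le> b" using H[of z] L by (simp add: field_simps)
    ultimately show "\<bar>x z * (H z / real L)\<bar> \<le> (x z + 2 * (\<delta> * real N)) * b"
      unfolding abs_mult by (intro mult_mono) auto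
  qed
  also have "\<dots> = ((\<Sum>z\<in>Z. x z) + 2 * (real N * (real (card Z) * \<delta>))) * b"
    by (simp add: sum_distrib_right[symmetric] sum.distrib)
  also have "\<dots> \<le> (2 * (real N * (real (card Z) * \<delta>))) * b"
    using sumx b0 by (intro mult_right_mono) auto
  finally have 3: "\<bar>(\<Sum>n\<in>B. H (a n)) - real N * ((\<Sum>z\<in>Z. m z * H z) / real L)\<bar>
    \<le> (2 * (real N * (real (card Z) * \<delta>))) * b" .
  have "real N * (\<eta> + 3 * b * (real (card Z) * \<delta>)) = real N * (b * (real (card Z) * \<delta>)) + real N * \<eta>
      + (2 * (real N * (real (card Z) * \<delta>))) * b"
    by (simp add: algebra_simps)
  then show ?thesis using 1 2 3 by linarith
qed

lemma named_blocks_locality: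
  assumes B: "block_starts L N B" and \<phi>: "\<And>n t. n \<in> B \<Longrightarrow> t < L \<Longrightarrow> \<phi> (n + t) = \<phi> n + t"
    and "0 < L"
  shows "card B * (L - 1) \<le> card {n \<in> {1..<N}. \<phi> (n + 1) = \<phi> n + 1}"
proof -
  have "card B * (L - 1) = card ((\<lambda>(n, t). n + t) ` (B \<times> {..<L - 1}))"
    by (subst card_image[OF inj_on_subset[OF block_starts_inj[OF B]]]) (auto simp: card_cartesian_product)
  also have "\<dots> \<le> card {n \<in> {1..<N}. \<phi> (n + 1) = \<phi> n + 1}"
  proof (intro card_mono image_subsetI)
    fix d assume "d \<in> B \<times> {..<L - 1}"
    then obtain n t where d: "d = (n, t)" "n \<in> B" "t < L - 1" by auto
    have "1 \<le> n \<and> n + L \<le> N + 1" using B d(2) unfolding block_starts_def by blast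
    then have "n + t \<in> {1..<N}" using d(3) by auto
    moreover have "\<phi> (n + t + 1) = \<phi> (n + t) + 1"
      using \<phi>[OF d(2), of t] \<phi>[OF d(2), of "t + 1"] d(3) by simp
    ultimately show "(case d of (n, t) \<Rightarrow> n + t) \<in> {n \<in> {1..<N}. \<phi> (n + 1) = \<phi> n + 1}"
      using d(1) by simp
  qed simp
  finally show ?thesis .
qed

section \<open>Orbit averages and integrals\<close>

lemma integral_empirical_measure:
  fixes f :: "'x::topological_space \<Rightarrow> real"
  assumes "continuous_on UNIV f"
  shows "(\<integral>y. f y \<partial>empirical_measure N x) = (\<Sum>n=1..N. f (x n)) / real N"
proof -
  have "x \<in> measurable (uniform_count_measure {1..N}) borel"
    by (auto simp: uniform_count_measure_def point_measure_def measurable_def)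
  then have "(\<integral>y. f y \<partial>empirical_measure N x) = (\<integral>n. f (x n) \<partial>uniform_count_measure {1..N})"
    unfolding empirical_measure_def
    using borel_measurable_continuous_onI[OF assms] by (rule integral_distr)
  also have "\<dots> = (\<Sum>n=1..N. f (x n)) / real N"
    unfolding uniform_count_measure_def
    by (subst lebesgue_integral_point_measure_finite) (auto simp: sum_divide_distrib)
  finally show ?thesis .
qed

lemma integrable_bounded_continuous:
  fixes f :: "'x::topological_space \<Rightarrow> real"
  assumes "prob_space \<mu>" "sets \<mu> = sets borel" "continuous_on UNIV f" "\<And>x. \<bar>f x\<bar> \<le> b"
  shows "integrable \<mu> f"
proof -
  interpret prob_space \<mu> by fact
  have "f \<in> borel_measurable \<mu>"
    using borel_measurable_continuous_onI[OF assms(3)] assms(2)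
    by (simp cong: measurable_cong_sets)
  then show ?thesis
    using assms(4) by (intro integrable_const_bound[of _ b]) auto
qed

lemma continuous_on_funpow:
  fixes T :: "'x::topological_space \<Rightarrow> 'x"
  assumes "continuous_on UNIV T"
  shows "continuous_on UNIV (T ^^ t)"
proof (induction t)
  case (Suc t)
  have "continuous_on UNIV (T \<circ> (T ^^ t))"
    using Suc assms by (intro continuous_on_compose) (auto intro: continuous_on_subset)
  then show ?case by simp
qed simp

lemma invariant_integral_funpow:
  fixes T :: "'x::topological_space \<Rightarrow> 'x" and F :: "'x \<Rightarrow> real"
  assumes "invariant_prob T \<mu>" and T: "continuous_on UNIV T" and F: "continuous_on UNIV F"
  shows "(\<integral>x. F ((T ^^ t) x) \<partial>\<mu>) = (\<integral>x. F x \<partial>\<mu>)"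
proof (induction t)
  case (Suc t)
  have meas: "T \<in> measurable \<mu> borel"
    using assms(1) borel_measurable_continuous_onI[OF T] unfolding invariant_prob_def
    by (simp cong: measurable_cong_sets)
  have "continuous_on UNIV (F \<circ> (T ^^ t))"
    using continuous_on_funpow[OF T] F by (intro continuous_on_compose) (auto intro: continuous_on_subset)
  then have "(\<lambda>x. F ((T ^^ t) x)) \<in> borel_measurable borel"
    using borel_measurable_continuous_onI by (simp add: comp_def)
  then have "(\<integral>x. F ((T ^^ t) (T x)) \<partial>\<mu>) = (\<integral>x. F ((T ^^ t) x) \<partial>distr \<mu> borel T)"
    using meas by (intro integral_distr[symmetric])
  also have "distr \<mu> borel T = \<mu>" using assms(1) by (simp add: invariant_prob_def)
  finally show ?case using Suc by (simp add: funpow_swap1)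
qed simp

text \<open>
  The measure-theoretic counterpart of \<open>named_blocks_sum_estimate\<close>. By invariance \<open>F\<close> may be replaced by its
  average along an orbit segment of length \<open>L\<close>, and on the support of \<open>h z\<close> that average is nearly
  constant.
\<close>

lemma integral_near_named_block_averages:
  fixes T :: "'x::topological_space \<Rightarrow> 'x" and F :: "'x \<Rightarrow> real" and h :: "'z \<Rightarrow> 'x \<Rightarrow> real"
  assumes inv: "invariant_prob T \<mu>" and T: "continuous_on UNIV T"
    and F: "continuous_on UNIV F" and b: "\<And>x. \<bar>F x\<bar> \<le> b" and "0 < L" and "finite Z"
    and h: "\<And>z. z \<in> Z \<Longrightarrow> continuous_on UNIV (h z)" and h0: "\<And>z x. 0 \<le> h z x"
    and h1: "\<And>x. (\<Sum>z\<in>Z. h z x) = 1"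
    and near: "\<And>z x. z \<in> Z \<Longrightarrow> 0 < h z x \<Longrightarrow> \<bar>(\<Sum>t<L. F ((T ^^ t) x)) - V z\<bar> \<le> real L * \<eta>"
  shows "\<bar>(\<integral>x. F x \<partial>\<mu>) - (\<Sum>z\<in>Z. (\<integral>x. h z x \<partial>\<mu>) * V z) / real L\<bar> \<le> \<eta>"
proof -
  interpret prob_space \<mu> using inv by (simp add: invariant_prob_def)
  note pr = inv[unfolded invariant_prob_def, THEN conjunct1]
    inv[unfolded invariant_prob_def, THEN conjunct2, THEN conjunct1]
  have L: "0 < real L" using \<open>0 < L\<close> by simp
  define A where "A x = (\<Sum>t<L. F ((T ^^ t) x))" for x
  have Ft: "continuous_on UNIV (\<lambda>x. F ((T ^^ t) x))" for t
    using continuous_on_compose[OF continuous_on_funpow[OF T] continuous_on_subset[OF F]]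
    by (simp add: comp_def)
  have intFt: "integrable \<mu> (\<lambda>x. F ((T ^^ t) x))" for t
    using b by (intro integrable_bounded_continuous[OF pr Ft])
  have intA: "integrable \<mu> A" unfolding A_def by (intro Bochner_Integration.integrable_sum intFt)
  have EA: "(\<integral>x. A x \<partial>\<mu>) = real L * (\<integral>x. F x \<partial>\<mu>)"
    unfolding A_def
    by (subst Bochner_Integration.integral_sum) (auto intro: intFt simp: invariant_integral_funpow[OF inv T F])
  have inth: "integrable \<mu> (h z)" if "z \<in> Z" for z
  proof (rule integrable_bounded_continuous[OF pr h[OF that]])
    fix x show "\<bar>h z x\<bar> \<le> 1"
      using member_le_sum[OF that, of "\<lambda>z. h z x"] h0 h1[of x] \<open>finite Z\<close> by simp
  qed
  define R where "R x = (\<Sum>z\<in>Z. h z x * V z)" for x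
  have intR: "integrable \<mu> R"
    unfolding R_def by (intro Bochner_Integration.integrable_sum integrable_mult_left inth)
  have ER: "(\<integral>x. R x \<partial>\<mu>) = (\<Sum>z\<in>Z. (\<integral>x. h z x \<partial>\<mu>) * V z)"
    unfolding R_def by (subst Bochner_Integration.integral_sum) (auto intro: inth)
  have "\<bar>A x - R x\<bar> \<le> real L * \<eta>" for x
  proof -
    have "A x - R x = (\<Sum>z\<in>Z. h z x * (A x - V z))"
      using h1[of x] by (simp add: R_def algebra_simps sum_subtractf sum_distrib_left[symmetric])
    also have "\<bar>\<dots>\<bar> \<le> (\<Sum>z\<in>Z. h z x * (real L * \<eta>))"
    proof (intro order.trans[OF sum_abs] sum_mono)
      fix z assume "z \<in> Z"
      then show "\<bar>h z x * (A x - V z)\<bar> \<le> h z x * (real L * \<eta>)"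
        using near[of z x] h0[of z x]
        by (cases "h z x = 0") (auto simp: abs_mult A_def intro!: mult_left_mono)
    qed
    also have "\<dots> = real L * \<eta>" by (simp add: sum_distrib_right[symmetric] h1)
    finally show ?thesis .
  qed
  then have "(\<integral>x. \<bar>A x - R x\<bar> \<partial>\<mu>) \<le> real L * \<eta>"
    using intA intR by (intro integral_le_const) auto
  then have "\<bar>\<integral>x. A x - R x \<partial>\<mu>\<bar> \<le> real L * \<eta>"
    using integral_abs_bound[of \<mu> "\<lambda>x. A x - R x"] by linarith
  then have *: "\<bar>real L * (\<integral>x. F x \<partial>\<mu>) - (\<Sum>z\<in>Z. (\<integral>x. h z x \<partial>\<mu>) * V z)\<bar> \<le> real L * \<eta>"
    using intA intR EA ER by simp
  have "\<bar>(\<integral>x. F x \<partial>\<mu>) - (\<Sum>z\<in>Z. (\<integral>x. h z x \<partial>\<mu>) * V z) / real L\<bar>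
      = \<bar>real L * (\<integral>x. F x \<partial>\<mu>) - (\<Sum>z\<in>Z. (\<integral>x. h z x \<partial>\<mu>) * V z)\<bar> / real L"
  proof -
    have "(\<integral>x. F x \<partial>\<mu>) - (\<Sum>z\<in>Z. (\<integral>x. h z x \<partial>\<mu>) * V z) / real L
        = (real L * (\<integral>x. F x \<partial>\<mu>) - (\<Sum>z\<in>Z. (\<integral>x. h z x \<partial>\<mu>) * V z)) / real L"
      using L by (simp add: field_simps)
    then show ?thesis using L by simp
  qed
  also have "\<dots> \<le> \<eta>" using * L by (simp add: pos_divide_le_eq mult.commute)
  finally show ?thesis .
qed

section \<open>Orbit partitions of unity and couplings\<close>

text \<open>
  A partition of unity subordinate to a finite cover by Bowen balls, indexed by the centres of the balls.
  Such functions replace a partition into sets with null boundary: their orbit averages converge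
  without further argument.
\<close>

lemma exists_orbit_partition_of_unity:
  fixes S :: "'a::metric_space \<Rightarrow> 'a"
  assumes "compact (UNIV :: 'a set)" and S: "continuous_on UNIV S" and "0 < \<delta>"
  shows "\<exists>(I :: 'a set) g :: 'a \<Rightarrow> 'a \<Rightarrow> real. finite I \<and> (\<forall>c\<in>I. continuous_on UNIV (g c)) \<and>
    (\<forall>c x. 0 \<le> g c x) \<and> (\<forall>x. (\<Sum>c\<in>I. g c x) = 1) \<and>
    (\<forall>c x t. 0 < g c x \<longrightarrow> t < L \<longrightarrow> dist ((S ^^ t) x) ((S ^^ t) c) < \<delta>)"
proof -
  \<comment> \<open>The product is positive exactly on the Bowen ball around \<open>c\<close>.\<close>
  define w where "w c x = (\<Prod>t<L. max 0 (\<delta> - dist ((S ^^ t) x) ((S ^^ t) c)))" for c x :: 'a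
  have w0: "0 \<le> w c x" for c x by (simp add: w_def prod_nonneg)
  have cont: "continuous_on UNIV (w c)" for c
    unfolding w_def
    by (intro continuous_intros continuous_on_max continuous_on_funpow S)
  have pos: "0 < w c x \<longleftrightarrow> (\<forall>t<L. dist ((S ^^ t) x) ((S ^^ t) c) < \<delta>)" for c x
  proof
    assume "0 < w c x"
    then have "w c x \<noteq> 0" by simp
    then have "\<And>t. t < L \<Longrightarrow> max 0 (\<delta> - dist ((S ^^ t) x) ((S ^^ t) c)) \<noteq> 0"
      by (simp add: w_def)
    then show "\<forall>t<L. dist ((S ^^ t) x) ((S ^^ t) c) < \<delta>"
      by (metis diff_gt_0_iff_gt max.absorb1 not_less)
  qed (auto simp: w_def intro!: prod_pos)
  define U where "U c = {x. 0 < w c x}" for c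
  have "open (U c)" for c
    unfolding U_def by (intro open_Collect_less continuous_on_const cont)
  moreover have "c \<in> U c" for c
    using \<open>0 < \<delta>\<close> by (simp add: U_def pos)
  ultimately obtain I where I: "finite I" "UNIV \<subseteq> (\<Union>c\<in>I. U c)"
    using compactE_image[OF assms(1), of UNIV U] by (metis UNIV_I UN_I subsetI)
  define W where "W x = (\<Sum>c\<in>I. w c x)" for x
  have W: "0 < W x" for x
  proof -
    obtain c where "c \<in> I" "0 < w c x" using I(2) by (auto simp: U_def)
    then show ?thesis unfolding W_def using I(1) w0 by (intro sum_pos2)
  qed
  have contW: "continuous_on UNIV W" unfolding W_def by (intro continuous_on_sum cont)
  have "continuous_on UNIV (\<lambda>x. w c x / W x)" for c
    using W by (intro continuous_on_divide cont contW) (auto simp: less_le)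
  moreover have "0 \<le> w c x / W x" for c x using w0 W[of x] by simp
  moreover have "(\<Sum>c\<in>I. w c x / W x) = 1" for x
    using W[of x] by (simp add: sum_divide_distrib[symmetric] W_def)
  moreover have "dist ((S ^^ t) x) ((S ^^ t) c) < \<delta>" if "0 < w c x / W x" "t < L" for c x t
    using that W[of x] pos[of c x] by (simp add: zero_less_divide_iff)
  ultimately show ?thesis
    using I(1) by (intro exI[of _ I] exI[of _ "\<lambda>c x. w c x / W x"]) auto
qed

text \<open>
  Disintegration of a finite coupling \<open>m\<close> over its first marginal. Rows of mass zero receive the
  uniform distribution.
\<close>

lemma exists_stochastic_weights:
  fixes m :: "'c \<Rightarrow> 'd \<Rightarrow> real"
  assumes "finite J" "J \<noteq> {}" and m: "\<And>c d. 0 \<le> m c d"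
  shows "\<exists>q. (\<forall>c d. 0 \<le> q c d) \<and> (\<forall>c. (\<Sum>d\<in>J. q c d) = 1) \<and>
    (\<forall>c. \<forall>d\<in>J. (\<Sum>d\<in>J. m c d) * q c d = m c d)"
proof -
  define r where "r c = (\<Sum>d\<in>J. m c d)" for c
  define q where "q c d = (if r c = 0 then 1 / real (card J) else m c d / r c)" for c d
  have "0 \<le> r c" for c unfolding r_def by (intro sum_nonneg m)
  then have "0 \<le> q c d" for c d using m by (simp add: q_def)
  moreover have "(\<Sum>d\<in>J. q c d) = 1" for c
  proof (cases "r c = 0")
    case False
    then have "(\<Sum>d\<in>J. q c d) = (\<Sum>d\<in>J. m c d) / r c"
      by (simp add: q_def sum_divide_distrib)
    then show ?thesis using False by (simp add: r_def)
  qed (use assms(1,2) in \<open>simp add: q_def\<close>)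
  moreover have "r c * q c d = m c d" if "d \<in> J" for c d
  proof (cases "r c = 0")
    case True
    then show ?thesis
      using that assms(1) m sum_nonneg_eq_0_iff[of J "m c"] by (simp add: r_def)
  qed (simp add: q_def)
  ultimately show ?thesis unfolding r_def by blast
qed

lemma funpow_map_prod:
  fixes f :: "'x \<Rightarrow> 'x" and g :: "'y \<Rightarrow> 'y"
  shows "(map_prod f g ^^ t) (x, y) = ((f ^^ t) x, (g ^^ t) y)"
  by (induction t) auto

section \<open>Permutations that realise a joining\<close>

text \<open>
  At stage \<open>k\<close> use an object for the largest \<open>m \<le> k\<close> for which one exists.
\<close>

lemma exists_antitone_diagonal:
  fixes P :: "nat \<Rightarrow> nat \<Rightarrow> 'b \<Rightarrow> bool"
  assumes ev: "\<And>m. \<forall>\<^sub>F k in sequentially. \<exists>x. P m k x"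
    and anti: "\<And>m m' k x. m \<le> m' \<Longrightarrow> P m' k x \<Longrightarrow> P m k x"
  shows "\<exists>X. \<forall>m. \<forall>\<^sub>F k in sequentially. P m k (X k)"
proof -
  define M where "M k = {m. m \<le> k \<and> (\<exists>x. P m k x)}" for k
  define X where "X k = (SOME x. P (Max (M k)) k x)" for k
  have "\<forall>\<^sub>F k in sequentially. P m k (X k)" for m
    using ev[of m] eventually_ge_at_top[of m]
  proof eventually_elim
    case (elim k)
    have fin: "finite (M k)" by (simp add: M_def)
    have mem: "m \<in> M k" using elim by (simp add: M_def)
    then have "Max (M k) \<in> M k" using fin by (intro Max_in) auto
    then have "\<exists>x. P (Max (M k)) k x" by (simp add: M_def)
    then have "P (Max (M k)) k (X k)" unfolding X_def by (rule someI_ex)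
    then show ?case using anti Max_ge[OF fin mem] by blast
  qed
  then show ?thesis by blast
qed

text \<open>
  The scale is \<open>1/(m + 1)\<close> throughout. The bound treats all test functions at once through their sup norm \<open>b\<close> and their oscillation \<open>\<eta>\<close> at this scale, so that a
  diagonal sequence works for every continuous function and no countable dense family of test functions
  enters.
\<close>

definition coupling_quality ::
    "('a::metric_space \<Rightarrow> 'a) \<Rightarrow> 'a \<Rightarrow> ('a \<times> 'a) measure \<Rightarrow> nat \<Rightarrow> nat \<Rightarrow> (nat \<Rightarrow> nat) \<Rightarrow> bool" where
  "coupling_quality S u \<Lambda> m N \<phi> \<longleftrightarrow> \<phi> permutes {1..N} \<and>
    1 - 2 / real (m + 1) \<le> real (card {n \<in> {1..<N}. \<phi> (n + 1) = \<phi> n + 1}) / real N \<and>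
    (\<forall>F b \<eta>. continuous_on UNIV F \<and> (\<forall>p. \<bar>F p\<bar> \<le> b) \<and>
      (\<forall>x x' y y'. dist x x' < 1 / real (m + 1) \<and> dist y y' < 1 / real (m + 1) \<longrightarrow>
        \<bar>F (x, y) - F (x', y')\<bar> \<le> \<eta>) \<longrightarrow>
      \<bar>(\<Sum>n=1..N. F ((S ^^ n) u, (S ^^ \<phi> n) u)) / real N - (\<integral>p. F p \<partial>\<Lambda>)\<bar> \<le> 2 * \<eta> + 3 * b / real (m + 1))"

lemma coupling_quality_antimono:
  assumes "m \<le> m'" and "coupling_quality S u \<Lambda> m' N \<phi>"
  shows "coupling_quality S u \<Lambda> m N \<phi>"
proof -
  have le: "1 / real (m' + 1) \<le> 1 / real (m + 1)" using assms(1) by (simp add: frac_le)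
  have loc: "1 - 2 / real (m + 1) \<le> 1 - 2 / real (m' + 1)" using assms(1) by (simp add: frac_le)
  show ?thesis
    unfolding coupling_quality_def
  proof (intro conjI allI impI)
    show "\<phi> permutes {1..N}" using assms(2) by (simp add: coupling_quality_def)
    show "1 - 2 / real (m + 1) \<le> real (card {n \<in> {1..<N}. \<phi> (n + 1) = \<phi> n + 1}) / real N"
      using assms(2) loc unfolding coupling_quality_def by linarith
  next
    fix F :: "'a \<times> 'a \<Rightarrow> real" and b \<eta>
    assume asm: "continuous_on UNIV F \<and> (\<forall>p. \<bar>F p\<bar> \<le> b) \<and>
      (\<forall>x x' y y'. dist x x' < 1 / real (m + 1) \<and> dist y y' < 1 / real (m + 1) \<longrightarrow>
        \<bar>F (x, y) - F (x', y')\<bar> \<le> \<eta>)"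
    then have F: "continuous_on UNIV F" "\<forall>p. \<bar>F p\<bar> \<le> b" by auto
    have "\<forall>x x' y y'. dist x x' < 1 / real (m' + 1) \<and> dist y y' < 1 / real (m' + 1) \<longrightarrow>
        \<bar>F (x, y) - F (x', y')\<bar> \<le> \<eta>"
      using asm le by (meson order_less_le_trans)
    then have *: "\<bar>(\<Sum>n=1..N. F ((S ^^ n) u, (S ^^ \<phi> n) u)) / real N - (\<integral>p. F p \<partial>\<Lambda>)\<bar>
        \<le> 2 * \<eta> + 3 * b / real (m' + 1)"
      using assms(2) F unfolding coupling_quality_def by blast
    have "0 \<le> b" using F(2) abs_ge_zero order_trans by blast
    then have "3 * b / real (m' + 1) \<le> 3 * b / real (m + 1)"
      using mult_left_mono[OF le, of "3 * b"] by simp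
    with * show "\<bar>(\<Sum>n=1..N. F ((S ^^ n) u, (S ^^ \<phi> n) u)) / real N - (\<integral>p. F p \<partial>\<Lambda>)\<bar>
        \<le> 2 * \<eta> + 3 * b / real (m + 1)" by linarith
  qed
qed

lemma joining_marginal_integral:
  fixes \<Lambda> :: "('a::metric_space \<times> 'a) measure" and f :: "'a \<Rightarrow> real"
  assumes "self_joining2 S \<kappa> \<Lambda>" and "continuous_on UNIV f"
  shows "(\<integral>p. f (fst p) \<partial>\<Lambda>) = (\<integral>x. f x \<partial>\<kappa>)" and "(\<integral>p. f (snd p) \<partial>\<Lambda>) = (\<integral>x. f x \<partial>\<kappa>)"
proof -
  have sets: "sets \<Lambda> = sets borel"
    using assms(1) by (simp add: self_joining2_def invariant_prob_def)
  have f: "f \<in> borel_measurable borel" using assms(2) by (rule borel_measurable_continuous_onI)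
  have "fst \<in> measurable \<Lambda> borel" "snd \<in> measurable \<Lambda> borel"
    using borel_measurable_continuous_onI[OF continuous_on_fst[OF continuous_on_id]]
      borel_measurable_continuous_onI[OF continuous_on_snd[OF continuous_on_id]]
    by (simp_all cong: measurable_cong_sets[OF sets refl])
  from integral_distr[OF this(1) f] integral_distr[OF this(2) f]
  show "(\<integral>p. f (fst p) \<partial>\<Lambda>) = (\<integral>x. f x \<partial>\<kappa>)" "(\<integral>p. f (snd p) \<partial>\<Lambda>) = (\<integral>x. f x \<partial>\<kappa>)"
    using assms(1) by (simp_all add: self_joining2_def)
qed

text \<open>
  Names are pairs \<open>(c, d)\<close> of centres of Bowen balls, and the joining gives the name \<open>(c, d)\<close> the
  mass \<open>w c d\<close>. The first coordinate spreads the weight \<open>g c x\<close> over the names \<open>(c, d)\<close> in proportion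
  to the row \<open>w c\<close>, the second one spreads \<open>g d y\<close> in proportion to the column of \<open>d\<close>. As both marginals
  of the joining are \<open>\<kappa>\<close>, the weight of \<open>(c, d)\<close> has \<open>\<kappa>\<close>-integral \<open>w c d\<close> in both cases, and genericity
  of the orbit turns this into the frequencies that the matching of blocks requires.
\<close>

lemma eventually_coupling_quality:
  fixes S :: "'a::metric_space \<Rightarrow> 'a"
  assumes comp: "compact (UNIV :: 'a set)" and S: "continuous_on UNIV S" and N: "strict_mono N"
    and generic: "quasi_generic S N u \<kappa>" and join: "self_joining2 S \<kappa> \<Lambda>"
  shows "\<forall>\<^sub>F k in sequentially. \<exists>\<phi>. coupling_quality S u \<Lambda> m (N k) \<phi>"
proof -
  define L where "L = m + 1"
  have "0 < L" by (simp add: L_def)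
  then have L_inv: "0 < 1 / real L" by simp
  have inv: "invariant_prob (map_prod S S) \<Lambda>" using join by (simp add: self_joining2_def)
  then have pr: "prob_space \<Lambda>" "sets \<Lambda> = sets borel" by (simp_all add: invariant_prob_def)
  obtain I :: "'a set" and g :: "'a \<Rightarrow> 'a \<Rightarrow> real" where part: "finite I \<and>
    (\<forall>c\<in>I. continuous_on UNIV (g c)) \<and> (\<forall>c x. 0 \<le> g c x) \<and> (\<forall>x. (\<Sum>c\<in>I. g c x) = 1) \<and>
    (\<forall>c x t. 0 < g c x \<longrightarrow> t < L \<longrightarrow> dist ((S ^^ t) x) ((S ^^ t) c) < 1 / real L)"
    using exists_orbit_partition_of_unity[OF comp S L_inv, of L] by (elim exE)
  then have "finite I"
    and gc: "\<And>c. c \<in> I \<Longrightarrow> continuous_on UNIV (g c)" and g0: "\<And>c x. 0 \<le> g c x"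
    and g1: "\<And>x. (\<Sum>c\<in>I. g c x) = 1"
    by simp_all
  have near: "dist ((S ^^ t) x) ((S ^^ t) c) < 1 / real L" if "0 < g c x" "t < L" for c x t
    using part that by simp
  have "I \<noteq> {}" using g1[of u] by auto
  define Z where "Z = I \<times> I"
  have finZ: "finite Z" using \<open>finite I\<close> by (simp add: Z_def)
  have Z0: "0 < card Z" using \<open>finite I\<close> \<open>I \<noteq> {}\<close> by (simp add: Z_def card_gt_0_iff)
  define h where "h = (\<lambda>(c, d) p. g c (fst p) * g d (snd p))"
  have h0: "0 \<le> h z p" for z p by (simp add: h_def case_prod_unfold g0)
  have h1: "(\<Sum>z\<in>Z. h z p) = 1" for p
  proof -
    have "(\<Sum>z\<in>Z. h z p) = (\<Sum>c\<in>I. g c (fst p)) * (\<Sum>d\<in>I. g d (snd p))"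
      by (simp add: Z_def h_def sum_product sum.cartesian_product case_prod_unfold)
    then show ?thesis by (simp add: g1)
  qed
  have hc: "continuous_on UNIV (h z)" if "z \<in> Z" for z
    using that unfolding Z_def h_def
    by (auto intro!: continuous_intros continuous_on_compose2[OF gc])
  have inth: "integrable \<Lambda> (h z)" if "z \<in> Z" for z
  proof (rule integrable_bounded_continuous[OF pr hc[OF that]])
    fix p show "\<bar>h z p\<bar> \<le> 1"
      using member_le_sum[OF that, of "\<lambda>z. h z p"] h0 h1[of p] finZ by simp
  qed
  define w where "w c d = (\<integral>p. h (c, d) p \<partial>\<Lambda>)" for c d
  have w0: "0 \<le> w c d" for c d unfolding w_def by (intro Bochner_Integration.integral_nonneg h0)
  have w1: "(\<Sum>z\<in>Z. case_prod w z) = 1"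
  proof -
    have "(\<Sum>z\<in>Z. case_prod w z) = (\<integral>p. (\<Sum>z\<in>Z. h z p) \<partial>\<Lambda>)"
      using inth by (simp add: w_def case_prod_unfold Bochner_Integration.integral_sum)
    then show ?thesis using pr(1) by (simp add: h1 prob_space.prob_space)
  qed
  have fst_marginal: "(\<Sum>d\<in>I. w c d) = (\<integral>x. g c x \<partial>\<kappa>)" if "c \<in> I" for c
  proof -
    have "(\<Sum>d\<in>I. w c d) = (\<integral>p. (\<Sum>d\<in>I. h (c, d) p) \<partial>\<Lambda>)"
      using inth that by (simp add: w_def Z_def Bochner_Integration.integral_sum)
    also have "(\<lambda>p. \<Sum>d\<in>I. h (c, d) p) = (\<lambda>p. g c (fst p))"
      by (simp add: h_def sum_distrib_left[symmetric] g1)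
    finally show ?thesis using joining_marginal_integral(1)[OF join gc[OF that]] by simp
  qed
  have snd_marginal: "(\<Sum>c\<in>I. w c d) = (\<integral>x. g d x \<partial>\<kappa>)" if "d \<in> I" for d
  proof -
    have "(\<Sum>c\<in>I. w c d) = (\<integral>p. (\<Sum>c\<in>I. h (c, d) p) \<partial>\<Lambda>)"
      using inth that by (simp add: w_def Z_def Bochner_Integration.integral_sum)
    also have "(\<lambda>p. \<Sum>c\<in>I. h (c, d) p) = (\<lambda>p. g d (snd p))"
      by (simp add: h_def sum_distrib_right[symmetric] g1)
    finally show ?thesis using joining_marginal_integral(2)[OF join gc[OF that]] by simp
  qed
  obtain q where q: "\<And>c d. 0 \<le> q c d" "\<And>c. (\<Sum>d\<in>I. q c d) = 1"
    "\<And>c d. d \<in> I \<Longrightarrow> (\<Sum>d\<in>I. w c d) * q c d = w c d"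
    using exists_stochastic_weights[of I w, OF \<open>finite I\<close> \<open>I \<noteq> {}\<close> w0] by blast
  obtain q' where q': "\<And>d c. 0 \<le> q' d c" "\<And>d. (\<Sum>c\<in>I. q' d c) = 1"
    "\<And>d c. c \<in> I \<Longrightarrow> (\<Sum>c\<in>I. w c d) * q' d c = w c d"
    using exists_stochastic_weights[of I "\<lambda>d c. w c d", OF \<open>finite I\<close> \<open>I \<noteq> {}\<close> w0] by blast
  define f where "f n = (\<lambda>(c, d). g c ((S ^^ n) u) * q c d)" for n
  define f' where "f' n = (\<lambda>(c, d). g d ((S ^^ n) u) * q' d c)" for n
  have f0: "0 \<le> f n z" "0 \<le> f' n z" for n z
    by (simp_all add: f_def f'_def case_prod_unfold g0 q q')
  have f1: "(\<Sum>z\<in>Z. f n z) = 1" "(\<Sum>z\<in>Z. f' n z) = 1" for n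
  proof -
    have "(\<Sum>z\<in>Z. f n z) = (\<Sum>c\<in>I. \<Sum>d\<in>I. g c ((S ^^ n) u) * q c d)"
      by (simp add: Z_def f_def sum.cartesian_product)
    then show "(\<Sum>z\<in>Z. f n z) = 1" by (simp add: sum_distrib_left[symmetric] q g1)
    have "(\<Sum>z\<in>Z. f' n z) = (\<Sum>c\<in>I. \<Sum>d\<in>I. g d ((S ^^ n) u) * q' d c)"
      by (simp add: Z_def f'_def sum.cartesian_product)
    also have "\<dots> = (\<Sum>d\<in>I. \<Sum>c\<in>I. g d ((S ^^ n) u) * q' d c)" by (rule sum.swap)
    finally show "(\<Sum>z\<in>Z. f' n z) = 1" by (simp add: sum_distrib_left[symmetric] q' g1)
  qed
  have orbit_avg: "(\<lambda>k. (\<Sum>n=1..N k. \<psi> ((S ^^ n) u)) / real (N k)) \<longlonglongrightarrow> (\<integral>x. \<psi> x \<partial>\<kappa>)"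
    if "continuous_on UNIV \<psi>" for \<psi> :: "'a \<Rightarrow> real"
    using generic that unfolding quasi_generic_def weak_star_conv_def
    by (simp add: integral_empirical_measure)
  have lim: "(\<lambda>k. (\<Sum>n=1..N k. f n z) / real (N k)) \<longlonglongrightarrow> case_prod w z"
    "(\<lambda>k. (\<Sum>n=1..N k. f' n z) / real (N k)) \<longlonglongrightarrow> case_prod w z" if zZ: "z \<in> Z" for z
  proof -
    obtain c d where z: "z = (c, d)" "c \<in> I" "d \<in> I" using zZ by (auto simp: Z_def)
    have "(\<lambda>k. (\<Sum>n=1..N k. g c ((S ^^ n) u)) / real (N k) * q c d) \<longlonglongrightarrow> w c d"
      using tendsto_mult_right[OF orbit_avg[OF gc[OF z(2)]], of "q c d"] q(3)[OF z(3), of c]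
        fst_marginal[OF z(2)] by simp
    then show "(\<lambda>k. (\<Sum>n=1..N k. f n z) / real (N k)) \<longlonglongrightarrow> case_prod w z"
      by (simp add: z(1) f_def sum_distrib_right)
    have "(\<lambda>k. (\<Sum>n=1..N k. g d ((S ^^ n) u)) / real (N k) * q' d c) \<longlonglongrightarrow> w c d"
      using tendsto_mult_right[OF orbit_avg[OF gc[OF z(3)]], of "q' d c"] q'(3)[OF z(2), of d]
        snd_marginal[OF z(3)] by simp
    then show "(\<lambda>k. (\<Sum>n=1..N k. f' n z) / real (N k)) \<longlonglongrightarrow> case_prod w z"
      by (simp add: z(1) f'_def sum_distrib_right)
  qed
  \<comment> \<open>With this tolerance the uncovered times have density at most \<open>1/L\<close>.\<close>
  define \<delta> where "\<delta> = 1 / (real L * real (card Z))"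
  have \<delta>0: "0 < \<delta>" using Z0 \<open>0 < L\<close> by (simp add: \<delta>_def)
  have \<delta>Z: "real (card Z) * \<delta> = 1 / real L" using Z0 by (simp add: \<delta>_def)
  have Ninf: "filterlim N sequentially sequentially" using N by (rule filterlim_subseq)
  have freqs: "\<forall>\<^sub>F k in sequentially. \<forall>z\<in>Z.
      case_prod w z - \<delta> / 2 < (\<Sum>n=1..N k. f n z) / real (N k) \<and>
      case_prod w z - \<delta> / 2 < (\<Sum>n=1..N k. f' n z) / real (N k)"
    using lim \<delta>0 finZ
    by (intro eventually_ball_finite ballI eventually_conj order_tendstoD(1)[OF lim(1)]
        order_tendstoD(1)[OF lim(2)]) auto
  have perms: "\<forall>\<^sub>F k in sequentially. \<exists>\<phi> B a. \<phi> permutes {1..N k} \<and> block_starts L (N k) B \<and>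
      (\<forall>n\<in>B. \<forall>t<L. \<phi> (n + t) = \<phi> n + t) \<and>
      (\<forall>n\<in>B. a n \<in> Z \<and> 0 < f n (a n) \<and> 0 < f' (\<phi> n) (a n)) \<and>
      (\<forall>z\<in>Z. min (\<Sum>n=1..N k. f n z) (\<Sum>n=1..N k. f' n z) - \<delta> / 2 * real (N k)
        \<le> real L * real (card {n \<in> B. a n = z}))"
    by (rule eventually_compose_filterlim[OF eventually_exists_named_permutation Ninf])
      (use \<open>0 < L\<close> finZ \<delta>0 f0 f1 in auto)
  have "\<forall>\<^sub>F k in sequentially. 0 < N k"
    by (rule eventually_compose_filterlim[OF eventually_gt_at_top Ninf])
  with freqs perms show ?thesis
  proof eventually_elim
    case (elim k)
    then obtain \<phi> B a where \<phi>: "\<phi> permutes {1..N k}" and B: "block_starts L (N k) B"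
      and shift: "\<And>n t. n \<in> B \<Longrightarrow> t < L \<Longrightarrow> \<phi> (n + t) = \<phi> n + t"
      and a: "\<And>n. n \<in> B \<Longrightarrow> a n \<in> Z \<and> 0 < f n (a n) \<and> 0 < f' (\<phi> n) (a n)"
      and count: "\<And>z. z \<in> Z \<Longrightarrow> min (\<Sum>n=1..N k. f n z) (\<Sum>n=1..N k. f' n z) - \<delta> / 2 * real (N k)
        \<le> real L * real (card {n \<in> B. a n = z})"
      by blast
    have Nk: "0 < real (N k)" using elim by simp
    have freq: "real (N k) * case_prod w z - \<delta> * real (N k) \<le> real L * real (card {n \<in> B. a n = z})"
      if "z \<in> Z" for z
    proof -
      have "real (N k) * (case_prod w z - \<delta> / 2) < (\<Sum>n=1..N k. f n z)"
        "real (N k) * (case_prod w z - \<delta> / 2) < (\<Sum>n=1..N k. f' n z)"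
        using elim(1) that Nk by (simp_all add: pos_less_divide_eq mult.commute)
      then have "real (N k) * (case_prod w z - \<delta> / 2) - \<delta> / 2 * real (N k)
          \<le> real L * real (card {n \<in> B. a n = z})"
        using count[OF that] by linarith
      then show ?thesis by (simp add: algebra_simps)
    qed
    have aZ: "\<And>n. n \<in> B \<Longrightarrow> a n \<in> Z" using a by blast
    have loc: "1 - 2 / real L \<le> real (card {n \<in> {1..<N k}. \<phi> (n + 1) = \<phi> n + 1}) / real (N k)"
    proof -
      have "real (N k) * (1 - 1 / real L) \<le> real L * real (card B)"
        using named_blocks_cover[OF block_starts_finite[OF B] finZ aZ w1 freq]
        unfolding \<delta>Z by (simp add: algebra_simps)
      then have "(1 - 1 / real L) * (real (N k) * (1 - 1 / real L)) \<le> (1 - 1 / real L) * (real L * real (card B))"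
        using \<open>0 < L\<close> by (intro mult_left_mono) auto
      also have "\<dots> = real (card B * (L - 1))"
        using \<open>0 < L\<close> by (simp add: of_nat_diff field_simps)
      also have "\<dots> \<le> real (card {n \<in> {1..<N k}. \<phi> (n + 1) = \<phi> n + 1})"
        using named_blocks_locality[OF B shift \<open>0 < L\<close>] by linarith
      finally have "(1 - 1 / real L) * (real (N k) * (1 - 1 / real L)) / real (N k)
          \<le> real (card {n \<in> {1..<N k}. \<phi> (n + 1) = \<phi> n + 1}) / real (N k)"
        using Nk by (intro divide_right_mono) auto
      moreover have "1 - 2 / real L \<le> (1 - 1 / real L) * (1 - 1 / real L)"
        by (simp add: algebra_simps)
      ultimately show ?thesis using Nk by simp
    qed
    have quality: "\<bar>(\<Sum>n=1..N k. F ((S ^^ n) u, (S ^^ \<phi> n) u)) / real (N k) - (\<integral>p. F p \<partial>\<Lambda>)\<bar>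
        \<le> 2 * \<eta> + 3 * b / real L"
      if F: "continuous_on UNIV F" and b: "\<And>p. \<bar>F p\<bar> \<le> b"
        and osc: "\<And>x x' y y'. dist x x' < 1 / real L \<Longrightarrow> dist y y' < 1 / real L \<Longrightarrow>
          \<bar>F (x, y) - F (x', y')\<bar> \<le> \<eta>" for F :: "'a \<times> 'a \<Rightarrow> real" and b \<eta>
    proof -
      have \<eta>0: "0 \<le> \<eta>" using osc[of u u u u] \<open>0 < L\<close> by simp
      define H where "H = (\<lambda>(c, d). \<Sum>t<L. F ((S ^^ t) c, (S ^^ t) d))"
      have H: "\<bar>H z\<bar> \<le> real L * b" for z
      proof -
        have "\<bar>H z\<bar> \<le> (\<Sum>t<L. b)" unfolding H_def case_prod_unfold
          by (intro order.trans[OF sum_abs] sum_mono b)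
        then show ?thesis by simp
      qed
      have block: "\<bar>(\<Sum>t<L. F ((S ^^ t) x, (S ^^ t) y)) - H (c, d)\<bar> \<le> real L * \<eta>"
        if "0 < g c x" "0 < g d y" for c d x y
      proof -
        have "\<bar>(\<Sum>t<L. F ((S ^^ t) x, (S ^^ t) y)) - H (c, d)\<bar> \<le> (\<Sum>t<L. \<eta>)"
          unfolding H_def prod.case sum_subtractf[symmetric]
          by (intro order.trans[OF sum_abs] sum_mono osc near that) auto
        then show ?thesis by simp
      qed
      define X where "X = (\<Sum>n=1..N k. F ((S ^^ n) u, (S ^^ \<phi> n) u))"
      define Y where "Y = (\<Sum>z\<in>Z. case_prod w z * H z) / real L"
      have XY: "\<bar>X - real (N k) * Y\<bar> \<le> real (N k) * (\<eta> + 3 * b * (real (card Z) * \<delta>))"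
        unfolding X_def Y_def
      proof (rule named_blocks_sum_estimate[OF B \<open>0 < L\<close> finZ aZ w1 freq b H _ \<eta>0])
        fix n assume n: "n \<in> B"
        obtain c d where cd: "a n = (c, d)" by (cases "a n")
        have "0 < g c ((S ^^ n) u)" "0 < g d ((S ^^ \<phi> n) u)"
          using a[OF n] g0[of c "(S ^^ n) u"] g0[of d "(S ^^ \<phi> n) u"]
          by (auto simp: cd f_def f'_def zero_less_mult_iff)
        note near_z = block[OF this]
        have orbit: "(S ^^ (i + t)) u = (S ^^ t) ((S ^^ i) u)" for i t
          by (simp add: add.commute[of i] funpow_add)
        have "(\<Sum>t<L. F ((S ^^ (n + t)) u, (S ^^ \<phi> (n + t)) u))
            = (\<Sum>t<L. F ((S ^^ t) ((S ^^ n) u), (S ^^ t) ((S ^^ \<phi> n) u)))"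
          using shift[OF n] by (intro sum.cong) (simp_all add: orbit)
        then show "\<bar>(\<Sum>t<L. F ((S ^^ (n + t)) u, (S ^^ \<phi> (n + t)) u)) - H (a n)\<bar> \<le> real L * \<eta>"
          using near_z by (simp add: cd)
      qed
      have "X / real (N k) - Y = (X - real (N k) * Y) / real (N k)"
        using Nk by (simp add: diff_divide_distrib)
      then have "\<bar>X / real (N k) - Y\<bar> = \<bar>X - real (N k) * Y\<bar> / real (N k)"
        by simp
      also have "\<dots> \<le> \<eta> + 3 * b / real L"
        using XY Nk unfolding \<delta>Z by (simp add: pos_divide_le_eq mult.commute)
      finally have "\<bar>X / real (N k) - Y\<bar> \<le> \<eta> + 3 * b / real L" .
      moreover have "\<bar>(\<integral>p. F p \<partial>\<Lambda>) - (\<Sum>z\<in>Z. (\<integral>p. h z p \<partial>\<Lambda>) * H z) / real L\<bar> \<le> \<eta>"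
      proof (rule integral_near_named_block_averages[OF inv _ F b \<open>0 < L\<close> finZ hc h0 h1])
        show "continuous_on UNIV (map_prod S S)"
          unfolding map_prod_def case_prod_unfold
          by (intro continuous_intros continuous_on_compose2[OF S]) auto
        fix z p assume "z \<in> Z" "0 < h z p"
        then show "\<bar>(\<Sum>t<L. F ((map_prod S S ^^ t) p)) - H z\<bar> \<le> real L * \<eta>"
          using block[of "fst z" "fst p" "snd z" "snd p"] g0[of "fst z" "fst p"] g0[of "snd z" "snd p"]
            funpow_map_prod[of _ S S "fst p" "snd p"]
          by (auto simp: h_def case_prod_unfold zero_less_mult_iff)
      qed
      moreover have "Y = (\<Sum>z\<in>Z. (\<integral>p. h z p \<partial>\<Lambda>) * H z) / real L"
        by (simp add: Y_def w_def case_prod_unfold)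
      ultimately show ?thesis unfolding X_def by linarith
    qed
    show ?case
      using \<phi> loc quality unfolding coupling_quality_def L_def by blast
  qed
qed

theorem proposition8p1:
  fixes S :: "'a::metric_space \<Rightarrow> 'a"
    and u :: 'a
    and N :: "nat \<Rightarrow> nat"
    and \<kappa> :: "'a measure"
    and \<Lambda> :: "('a \<times> 'a) measure"
  assumes "compact (UNIV :: 'a set)"
    and "\<exists>T. homeomorphism UNIV UNIV S T"
    and "strict_mono N"
    and "invariant_prob S \<kappa>"
    and "quasi_generic S N u \<kappa>"
    and "self_joining2 S \<kappa> \<Lambda>"
  shows "\<exists>\<phi> :: nat \<Rightarrow> nat \<Rightarrow> nat. locally_orbital N \<phi> \<and>
    weak_star_conv
      (\<lambda>k. empirical_measure (N k) (\<lambda>n. ((S ^^ n) u, (S ^^ \<phi> k n) u))) \<Lambda>"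
proof -
  have S: "continuous_on UNIV S" using assms(2) by (auto simp: homeomorphism_def)
  obtain \<psi> where \<psi>: "\<And>m. \<forall>\<^sub>F k in sequentially. coupling_quality S u \<Lambda> m (N k) (\<psi> k)"
    using exists_antitone_diagonal[of "\<lambda>m k. coupling_quality S u \<Lambda> m (N k)"]
      eventually_coupling_quality[OF assms(1) S assms(3,5,6)] coupling_quality_antimono
    by metis
  \<comment> \<open>The diagonal sequence is controlled only for large \<open>k\<close>; before that any permutation will do.\<close>
  define \<phi> where "\<phi> k = (if \<psi> k permutes {1..N k} then \<psi> k else id)" for k
  have perm: "\<phi> k permutes {1..N k}" for k by (simp add: \<phi>_def permutes_id)
  have quality: "\<forall>\<^sub>F k in sequentially. coupling_quality S u \<Lambda> m (N k) (\<phi> k)" for m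
    using \<psi>[of m] by eventually_elim (simp add: \<phi>_def coupling_quality_def)
  have small: "\<exists>m::nat. c / real (m + 1) < e" if "0 < e" "0 \<le> c" for c e :: real
  proof -
    have "(\<lambda>m. c * inverse (real (Suc m))) \<longlonglongrightarrow> c * 0"
      by (intro tendsto_intros LIMSEQ_inverse_real_of_nat)
    then have "\<forall>\<^sub>F m in sequentially. c * inverse (real (Suc m)) < e"
      using that by (intro order_tendstoD) auto
    then show ?thesis by (auto simp: divide_inverse eventually_sequentially)
  qed
  have "locally_orbital N \<phi>"
    unfolding locally_orbital_def
  proof (intro conjI allI perm LIMSEQ_I)
    fix e :: real assume "0 < e"
    then obtain m :: nat where m: "2 / real (m + 1) < e" using small[of e 2] by auto
    from quality[of m]
    have "\<forall>\<^sub>F k in sequentially. norm (real (card {n \<in> {1..<N k}. \<phi> k (n + 1) = \<phi> k n + 1}) / real (N k) - 1) < e"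
    proof eventually_elim
      case (elim k)
      have "card {n \<in> {1..<N k}. \<phi> k (n + 1) = \<phi> k n + 1} \<le> card {1..N k}"
        by (intro card_mono) auto
      then have "real (card {n \<in> {1..<N k}. \<phi> k (n + 1) = \<phi> k n + 1}) / real (N k) \<le> 1"
        by (cases "N k = 0") (simp_all add: pos_divide_le_eq)
      moreover have "1 - 2 / real (m + 1) \<le> real (card {n \<in> {1..<N k}. \<phi> k (n + 1) = \<phi> k n + 1}) / real (N k)"
        using elim by (simp add: coupling_quality_def)
      ultimately show ?case unfolding real_norm_def using m by linarith
    qed
    then show "\<exists>k0. \<forall>k\<ge>k0. norm (real (card {n \<in> {1..<N k}. \<phi> k (n + 1) = \<phi> k n + 1}) / real (N k) - 1) < e"
      by (simp add: eventually_sequentially)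
  qed
  moreover have "weak_star_conv (\<lambda>k. empirical_measure (N k) (\<lambda>n. ((S ^^ n) u, (S ^^ \<phi> k n) u))) \<Lambda>"
    unfolding weak_star_conv_def
  proof (intro allI impI)
    fix F :: "'a \<times> 'a \<Rightarrow> real" assume F: "continuous_on UNIV F"
    have comp: "compact (UNIV :: ('a \<times> 'a) set)"
      using compact_Times[OF assms(1) assms(1)] by simp
    have "bounded (range F)" using compact_continuous_image[OF F comp] by (rule compact_imp_bounded)
    then obtain b where b: "\<And>p. \<bar>F p\<bar> \<le> b" by (auto simp: bounded_iff)
    have b0: "0 \<le> b" using b[of undefined] by linarith
    have "(\<lambda>k. (\<Sum>n=1..N k. F ((S ^^ n) u, (S ^^ \<phi> k n) u)) / real (N k)) \<longlonglongrightarrow> (\<integral>p. F p \<partial>\<Lambda>)"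
    proof (rule LIMSEQ_I)
      fix e :: real assume "0 < e"
      have "uniformly_continuous_on UNIV F" using F comp by (rule compact_uniformly_continuous)
      then obtain d where d: "0 < d" "\<And>p p'. dist p p' < d \<Longrightarrow> dist (F p) (F p') < e / 4"
        unfolding uniformly_continuous_on_def using \<open>0 < e\<close> by (metis UNIV_I zero_less_divide_iff zero_less_numeral)
      obtain m1 :: nat where m1: "2 / real (m1 + 1) < d" using small[of d 2] d by auto
      obtain m2 :: nat where m2: "3 * b / real (m2 + 1) < e / 2" using small[of "e / 2" "3 * b"] \<open>0 < e\<close> b0 by auto
      define m where "m = max m1 m2"
      have m: "2 / real (m + 1) < d" "3 * b / real (m + 1) < e / 2"
      proof -
        have "2 / real (m + 1) \<le> 2 / real (m1 + 1)" by (intro divide_left_mono) (auto simp: m_def)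
        then show "2 / real (m + 1) < d" using m1 by linarith
        have "3 * b / real (m + 1) \<le> 3 * b / real (m2 + 1)" using b0 by (intro divide_left_mono) (auto simp: m_def)
        then show "3 * b / real (m + 1) < e / 2" using m2 by linarith
      qed
      have osc: "\<bar>F (x, y) - F (x', y')\<bar> \<le> e / 4"
        if "dist x x' < 1 / real (m + 1)" "dist y y' < 1 / real (m + 1)" for x x' y y'
      proof -
        have "dist (x, y) (x', y') \<le> dist x x' + dist y y'"
          unfolding dist_Pair_Pair by (rule sqrt_sum_squares_le_sum) auto
        then have "dist (x, y) (x', y') < d" using that m(1) by simp
        then show ?thesis using d(2) by (force simp: dist_real_def)
      qed
      from quality[of m]
      have "\<forall>\<^sub>F k in sequentially.
        norm ((\<Sum>n=1..N k. F ((S ^^ n) u, (S ^^ \<phi> k n) u)) / real (N k) - (\<integral>p. F p \<partial>\<Lambda>)) < e"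
      proof eventually_elim
        case (elim k)
        have "\<bar>(\<Sum>n=1..N k. F ((S ^^ n) u, (S ^^ \<phi> k n) u)) / real (N k) - (\<integral>p. F p \<partial>\<Lambda>)\<bar>
            \<le> 2 * (e / 4) + 3 * b / real (m + 1)"
          using elim F b osc unfolding coupling_quality_def by blast
        then show ?case unfolding real_norm_def using m(2) by linarith
      qed
      then show "\<exists>k0. \<forall>k\<ge>k0.
        norm ((\<Sum>n=1..N k. F ((S ^^ n) u, (S ^^ \<phi> k n) u)) / real (N k) - (\<integral>p. F p \<partial>\<Lambda>)) < e"
        by (simp add: eventually_sequentially)
    qed
    then show "(\<lambda>k. \<integral>p. F p \<partial>empirical_measure (N k) (\<lambda>n. ((S ^^ n) u, (S ^^ \<phi> k n) u)))
        \<longlonglongrightarrow> (\<integral>p. F p \<partial>\<Lambda>)"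
      by (simp add: integral_empirical_measure[OF F])
  qed
  ultimately show ?thesis by blast
qed

end
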